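(* For every integer $n\ge 2$, $$\min\{\kappa_n,\ \kappa^*_{n+1}\}\ \ge\ \frac{n+1}{3}.$$
   Context: Complex algebraic numbers are called conjugate (over $\mathbb{Q}$) if they are roots of the same irreducible (over $\mathbb{Q}$) polynomial with rational integer coefficients. The height $H(\alpha)$ of an algebraic number $\alpha$ is the absolute height (the maximum of the absolute values of the coefficients) of the minimal polynomial of $\alpha$ over $\mathbb{Z}$ (the primitive irreducible integer polynomial with root $\alpha$). For an integer $n\ge 2$, $\kappa_n$ (respectively $\kappa^*_n$) denotes the infimum of the real numbers $\kappa$ such that the inequality $$|\alpha_1-\alpha_2|>H(\alpha_1)^{-\kappa}$$ holds for arbitrary conjugate algebraic numbers (respectively conjugate algebraic integers) $\alpha_1\neq\alpha_2$ in $\mathbb{C}$ of degree $n$ with sufficiently large height $H(\alpha_1)$. *)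

theory Defs
  imports
    Complex_Main
    "HOL-Library.Extended_Real"
    "HOL-Computational_Algebra.Polynomial_Factorial"
begin

definition irreducible_over_rat :: "int poly \<Rightarrow> bool" where
  "irreducible_over_rat p \<longleftrightarrow> irreducible (map_poly rat_of_int p)"

definition conjugate_over_rat :: "complex \<Rightarrow> complex \<Rightarrow> bool" where
  "conjugate_over_rat \<alpha> \<beta> \<longleftrightarrow>
     (\<exists>p :: int poly. irreducible_over_rat p
        \<and> poly (map_poly of_int p) \<alpha> = 0 \<and> poly (map_poly of_int p) \<beta> = 0)"

text \<open>
  The minimal polynomial over the integers is only determined up to sign, so the positive leading
  coefficient is chosen; degree and height do not depend on this choice. The description is
  meaningful only if the argument is algebraic.
\<close>

definition int_min_poly :: "complex \<Rightarrow> int poly" where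
  "int_min_poly \<alpha> = (THE p. content p = 1 \<and> irreducible_over_rat p \<and> lead_coeff p > 0
                          \<and> poly (map_poly of_int p) \<alpha> = 0)"

definition alg_degree :: "complex \<Rightarrow> nat" where
  "alg_degree \<alpha> = degree (int_min_poly \<alpha>)"

definition alg_height :: "complex \<Rightarrow> int" where
  "alg_height \<alpha> = Max (abs ` set (coeffs (int_min_poly \<alpha>)))"

definition root_separation_exponents :: "complex set \<Rightarrow> nat \<Rightarrow> real set" where
  "root_separation_exponents A n =
     {\<kappa>. \<exists>H0 :: int. \<forall>\<alpha>1\<in>A. \<forall>\<alpha>2\<in>A.
          conjugate_over_rat \<alpha>1 \<alpha>2 \<and> \<alpha>1 \<noteq> \<alpha>2 \<and> alg_degree \<alpha>1 = n \<and> alg_height \<alpha>1 \<ge> H0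
          \<longrightarrow> cmod (\<alpha>1 - \<alpha>2) > real_of_int (alg_height \<alpha>1) powr (- \<kappa>)}"

text \<open>
  The infimum is taken in the extended reals, where the infimum of the empty set is
  \<open>\<infinity>\<close>, because on type \<^typ>\<open>real\<close> the infimum of an empty set or of a set
  unbounded below is an unspecified value.
\<close>

definition kappa :: "nat \<Rightarrow> ereal" where
  "kappa n = (INF \<kappa>\<in>root_separation_exponents {\<alpha>. algebraic \<alpha>} n. ereal \<kappa>)"

definition kappa_star :: "nat \<Rightarrow> ereal" where
  "kappa_star n = (INF \<kappa>\<in>root_separation_exponents {\<alpha>. algebraic_int \<alpha>} n. ereal \<kappa>)"

end

theory Submission
  imports Defs "HOL-Computational_Algebra.Field_as_Ring"
begin

text \<open>
  Both lower bounds come from explicit families of irreducible integer polynomials that have two very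
  close real roots. If the coefficients of the family are \<open>O(b^u)\<close> and two of the roots are
  \<open>O(b^(-v))\<close> apart, where \<open>b \<rightarrow> \<infinity>\<close>, then no exponent below \<open>v / u\<close> can occur in
  the separation inequality (\<open>close_root_family_exponent\<close>). The heights of the roots need not be
  estimated from below: polynomials of bounded degree and height are finite in number, so close roots
  force large heights.

  The main family perturbs a square. The polynomial \<open>p = x^k - a x + 1\<close> has a root \<open>\<xi>\<close> slightly above
  \<open>1 / a\<close>, at which \<open>a \<xi> - 1 = \<xi>^k\<close> has the tiny size \<open>a^(-k)\<close>. In
  \<open>P = (x + 1)^d p^2 - 2 x^j (a x - 1)^2\<close> the double root \<open>\<xi>\<close> of the first summand is therefore disturbed
  only by an amount of size \<open>a^(-j-2k)\<close>, and since \<open>p'(\<xi>)\<close> has size \<open>a\<close>, it splits into two real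
  roots at distance about \<open>a^(-(j+2k+2)/2)\<close>. The height has order \<open>a^2\<close>, which gives the exponent
  \<open>(j + 2 k + 2) / 4\<close>. The degree \<open>n\<close> is \<open>d + 2 k\<close>; the best choice is \<open>j = n - 2\<close> in general, and
  \<open>j = n - 3\<close> if \<open>P\<close> has to be monic.

  If \<open>k\<close> is a power of \<open>2\<close> and \<open>a\<close> is even, then \<open>P\<close> is congruent to \<open>(x + 1)^n\<close> modulo \<open>2\<close> while
  \<open>P(-1)\<close> is twice an odd number, so \<open>P\<close> is irreducible by Eisenstein's criterion. Some power of \<open>2\<close>
  lies in the interval from \<open>n / 4\<close> (exclusive) to \<open>n / 2\<close> (inclusive), and any such \<open>k \<ge> 2\<close> is large
  enough: it gives \<open>(n + 2 k) / 4 \<ge> (n + 1) / 3\<close> in general and \<open>(n - 1 + 2 k) / 4 \<ge> n / 3\<close> in the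
  monic case.

  This settles all degrees from \<open>4\<close> on. Quadratic numbers and cubic integers are handled by Mignotte's
  polynomials \<open>x^m - 2 (a x - 1)^2\<close>, with exponent \<open>(m + 2) / 4\<close>. For cubic numbers, where
  \<open>4 / 3\<close> is needed and \<open>5 / 4\<close> does not suffice, the roots of \<open>y^3 - t y - 1\<close> are moved by a
  unimodular Moebius transformation chosen so that the height stays small; this gives \<open>13 / 8\<close>.
\<close>

section \<open>Irreducibility over the rationals\<close>

lemma map_poly_of_int_add: "map_poly of_int (p + q) = (map_poly of_int p + map_poly of_int q :: 'a::comm_ring_1 poly)"
  by (intro poly_eqI) (simp add: coeff_map_poly)

lemma map_poly_of_int_diff: "map_poly of_int (p - q) = (map_poly of_int p - map_poly of_int q :: 'a::comm_ring_1 poly)"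
  by (intro poly_eqI) (simp add: coeff_map_poly)

lemma map_poly_of_int_mult: "map_poly of_int (p * q) = (map_poly of_int p * map_poly of_int q :: 'a::comm_ring_1 poly)"
  by (intro poly_eqI) (simp add: coeff_map_poly coeff_mult)

lemma map_poly_of_int_power: "map_poly of_int (p ^ n) = (map_poly of_int p ^ n :: 'a::comm_ring_1 poly)"
  by (induction n) (simp_all add: map_poly_of_int_mult)

lemma map_poly_of_int_smult: "map_poly of_int (smult c p) = (smult (of_int c) (map_poly of_int p) :: 'a::comm_ring_1 poly)"
  by (intro poly_eqI) (simp add: coeff_map_poly)

lemma map_poly_of_int_pCons: "map_poly of_int (pCons c p) = (pCons (of_int c) (map_poly of_int p) :: 'a::comm_ring_1 poly)"
  by (intro poly_eqI) (simp add: coeff_map_poly coeff_pCons split: nat.splits)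

lemma map_poly_of_int_monom: "map_poly of_int (monom c n) = (monom (of_int c) n :: 'a::comm_ring_1 poly)"
  by (intro poly_eqI) (simp add: coeff_map_poly)

lemmas map_poly_of_int_simps = map_poly_of_int_add map_poly_of_int_diff map_poly_of_int_mult
  map_poly_of_int_power map_poly_of_int_smult map_poly_of_int_pCons map_poly_of_int_monom

lemma map_poly_of_int_eq_iff:
  "(map_poly of_int p :: 'a::{comm_ring_1,ring_char_0} poly) = map_poly of_int q \<longleftrightarrow> p = q"
  by (simp add: poly_eq_iff coeff_map_poly)

lemma degree_map_poly_of_int: "degree (map_poly of_int p :: 'a::{comm_ring_1,ring_char_0} poly) = degree p"
  by (cases "p = 0") (simp_all add: degree_map_poly)

lemma map_poly_of_int_eq_0_iff: "(map_poly of_int p :: 'a::{comm_ring_1,ring_char_0} poly) = 0 \<longleftrightarrow> p = 0"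
  using map_poly_of_int_eq_iff[of p 0] by simp

lemma rat_poly_clear_denominators:
  fixes A :: "rat poly"
  shows "\<exists>d A'. d \<noteq> (0::int) \<and> smult (of_int d) A = map_poly of_int A'"
proof (induction A)
  case 0
  show ?case by (intro exI[of _ 1] exI[of _ 0]) simp
next
  case (pCons a A)
  obtain d A' where d: "d \<noteq> 0" "smult (of_int d) A = map_poly of_int A'"
    using pCons.IH by blast
  obtain u v where uv: "a = of_int u / of_int v" "v \<noteq> 0"
    by (cases a) (auto simp: Fract_of_int_quotient)
  have "smult (of_int (v * d)) (pCons a A) = map_poly of_int (pCons (u * d) (smult v A'))"
    using uv d(2) by (simp add: map_poly_of_int_simps flip: d(2))
  then show ?case
    using uv d by (metis mult_eq_0_iff)
qed

lemma rat_poly_primitive_multiple: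
  fixes A :: "rat poly"
  assumes "A \<noteq> 0"
  shows "\<exists>c A'. c \<noteq> 0 \<and> content A' = 1 \<and> A = smult c (map_poly of_int A')"
proof -
  obtain d A' where d: "d \<noteq> 0" "smult (of_int d) A = map_poly of_int A'"
    using rat_poly_clear_denominators by blast
  have "A' \<noteq> 0"
    using d assms by (metis map_poly_0 of_int_eq_0_iff smult_eq_0_iff)
  have "map_poly of_int A' = (smult (of_int (content A')) (map_poly of_int (primitive_part A')) :: rat poly)"
    by (metis content_times_primitive_part map_poly_of_int_smult)
  then have "A = smult (of_int (content A') / of_int d) (map_poly of_int (primitive_part A'))"
    using d by (metis (no_types, lifting) divide_inverse_commute mult.commute of_int_eq_0_iff smult_1_left smult_smult
        left_inverse)
  moreover have "of_int (content A') / (of_int d :: rat) \<noteq> 0"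
    using \<open>A' \<noteq> 0\<close> d by simp
  ultimately show ?thesis
    using \<open>A' \<noteq> 0\<close> content_primitive_part by blast
qed

text \<open>
  Clearing the denominator of \<open>c\<close> and comparing contents shows that the denominator divides the
  numerator. This is the form in which Gauss's lemma is used below.
\<close>
lemma primitive_rat_associated:
  fixes P Q :: "int poly"
  assumes "content Q = 1" "map_poly of_int P = smult (c :: rat) (map_poly of_int Q)"
  shows "\<exists>e. P = smult e Q"
proof -
  obtain u v where uv: "c = of_int u / of_int v" "v \<noteq> 0"
    by (cases c) (auto simp: Fract_of_int_quotient)
  have "(map_poly of_int (smult v P) :: rat poly) = map_poly of_int (smult u Q)"
    using assms(2) uv by (simp add: map_poly_of_int_smult)
  then have eq: "smult v P = smult u Q"
    by (simp add: map_poly_of_int_eq_iff)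
  then have "content (smult v P) = content (smult u Q)" by simp
  then have "\<bar>v\<bar> * content P = \<bar>u\<bar>"
    using assms(1) by (simp add: content_smult)
  then have "v dvd u" by (metis abs_dvd_iff dvd_abs_iff dvd_triv_left)
  then obtain e where "u = v * e" by blast
  then have "smult v P = smult v (smult e Q)" using eq by simp
  then show ?thesis using uv(2) by (metis smult_cancel)
qed

text \<open>
  A rational factorization can be rescaled to one into integer polynomials, because the product of
  primitive polynomials is primitive.
\<close>
lemma irreducible_over_rat_if_irreducible_factors:
  fixes P :: "int poly"
  assumes "degree P > 0"
    and "\<And>A B. P = A * B \<Longrightarrow> degree A = 0 \<or> degree B = 0"
  shows "irreducible_over_rat P"
  unfolding irreducible_over_rat_def
proof (rule irreducibleI)
  show "map_poly rat_of_int P \<noteq> 0"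
    using assms(1) by (auto simp: map_poly_of_int_eq_0_iff)
  show "\<not> map_poly rat_of_int P dvd 1"
    using assms(1) by (auto simp: degree_map_poly_of_int dest!: dvd_imp_degree_le)
next
  fix A B :: "rat poly"
  assume AB: "map_poly rat_of_int P = A * B"
  have P0: "map_poly rat_of_int P \<noteq> 0"
    using assms(1) by (auto simp: map_poly_of_int_eq_0_iff)
  then have "A \<noteq> 0" "B \<noteq> 0" using AB by auto
  obtain c A' where A: "c \<noteq> 0" "content A' = 1" "A = smult c (map_poly of_int A')"
    using rat_poly_primitive_multiple[OF \<open>A \<noteq> 0\<close>] by blast
  obtain d B' where B: "d \<noteq> 0" "content B' = 1" "B = smult d (map_poly of_int B')"
    using rat_poly_primitive_multiple[OF \<open>B \<noteq> 0\<close>] by blast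
  have "map_poly rat_of_int P = smult (c * d) (map_poly of_int (A' * B'))"
    by (simp add: AB A B map_poly_of_int_mult mult.commute)
  then obtain e where "P = smult e (A' * B')"
    using primitive_rat_associated[of "A' * B'" P "c * d"] A B by (auto simp: content_mult)
  then have "P = smult e A' * B'" by simp
  moreover from this have "e \<noteq> 0" using assms(1) by auto
  ultimately have "degree A' = 0 \<or> degree B' = 0"
    using assms(2) by fastforce
  then have "degree A = 0 \<or> degree B = 0"
    using A B by (auto simp: degree_map_poly_of_int)
  then show "A dvd 1 \<or> B dvd 1"
    using \<open>A \<noteq> 0\<close> \<open>B \<noteq> 0\<close> by (simp add: is_unit_iff_degree)
qed

text \<open>
  Let \<open>P = A B\<close> with both degrees positive. Since \<open>l\<^sup>2\<close> does not divide the constant coefficient, one factor,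
  say \<open>B\<close>, has a constant coefficient prime to \<open>l\<close>. The lowest coefficient of \<open>A\<close> not divisible by \<open>l\<close>, at
  index \<open>i\<close>, then makes \<open>coeff P i\<close> prime to \<open>l\<close>, although \<open>i \<le> degree A < degree P\<close>.
\<close>
lemma eisenstein:
  fixes P :: "int poly" and l :: int
  assumes "prime l" "degree P > 0" "\<not> l dvd lead_coeff P"
    and low: "\<And>i. i < degree P \<Longrightarrow> l dvd coeff P i"
    and const: "\<not> l\<^sup>2 dvd coeff P 0"
  shows "irreducible_over_rat P"
proof (rule irreducible_over_rat_if_irreducible_factors[OF assms(2)], rule ccontr)
  have main: False
    if AB: "P = A * B" and dA: "degree A < degree P" and b0: "\<not> l dvd coeff B 0" for A B :: "int poly"
  proof -
    have "\<not> l dvd coeff A (degree A)"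
      using assms(3) AB by (auto simp: lead_coeff_mult)
    define i where "i = (LEAST i. \<not> l dvd coeff A i)"
    have i: "\<not> l dvd coeff A i" "i \<le> degree A" "\<And>r. r < i \<Longrightarrow> l dvd coeff A r"
      using LeastI[of "\<lambda>i. \<not> l dvd coeff A i", OF \<open>\<not> l dvd coeff A (degree A)\<close>]
        Least_le[of "\<lambda>i. \<not> l dvd coeff A i", OF \<open>\<not> l dvd coeff A (degree A)\<close>]
        not_less_Least[of _ "\<lambda>i. \<not> l dvd coeff A i"]
      unfolding i_def by blast+
    have "coeff P i = (\<Sum>r\<le>i. coeff A r * coeff B (i - r))"
      by (simp add: AB coeff_mult)
    also have "\<dots> = (\<Sum>r<i. coeff A r * coeff B (i - r)) + coeff A i * coeff B 0"
      by (simp flip: lessThan_Suc_atMost)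
    finally have "coeff A i * coeff B 0 = coeff P i - (\<Sum>r<i. coeff A r * coeff B (i - r))"
      by simp
    also have "l dvd \<dots>"
      using i dA by (intro dvd_diff low dvd_sum) auto
    finally show False
      using i(1) b0 assms(1) by (simp add: prime_dvd_mult_iff)
  qed
  fix A B :: "int poly"
  assume AB: "P = A * B" and "\<not> (degree A = 0 \<or> degree B = 0)"
  then have deg: "degree A < degree P" "degree B < degree P"
    using assms(2) degree_mult_eq[of A B] by (cases "A = 0 \<or> B = 0"; force)+
  have "\<not> (l dvd coeff A 0 \<and> l dvd coeff B 0)"
    using const by (auto simp: AB coeff_mult_0 power2_eq_square intro: mult_dvd_mono)
  then show False
    using main[OF AB deg(1)] main[of B A] AB deg(2) by (auto simp: mult.commute)
qed

lemma map_poly_of_int_pcompose: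
  "map_poly of_int (p \<circ>\<^sub>p q) = (map_poly of_int p \<circ>\<^sub>p map_poly of_int q :: 'a::comm_ring_1 poly)"
  by (induction p) (simp_all add: map_poly_of_int_simps pcompose_pCons)

lemma irreducible_over_rat_shift:
  fixes P :: "int poly" and s :: int
  assumes "irreducible_over_rat (P \<circ>\<^sub>p [:s, 1:])"
  shows "irreducible_over_rat P"
  unfolding irreducible_over_rat_def
proof (rule irreducibleI)
  have irr: "irreducible (map_poly rat_of_int P \<circ>\<^sub>p [:of_int s, 1:])"
    using assms by (simp add: irreducible_over_rat_def map_poly_of_int_pcompose map_poly_of_int_pCons)
  then show "map_poly rat_of_int P \<noteq> 0" by auto
  show "\<not> map_poly rat_of_int P dvd 1"
  proof
    assume "map_poly rat_of_int P dvd 1"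
    then obtain c where c: "map_poly rat_of_int P = [:c:]" "c dvd 1"
      by (auto simp: is_unit_poly_iff)
    show False using irr unfolding c pcompose_const using c(2)
      by (auto simp: irreducible_def is_unit_poly_iff)
  qed
  fix A B assume "map_poly rat_of_int P = A * B"
  then have "A \<circ>\<^sub>p [:of_int s, 1:] dvd 1 \<or> B \<circ>\<^sub>p [:of_int s, 1:] dvd 1"
    using irr by (auto simp: pcompose_mult dest: irreducibleD)
  moreover have "C dvd 1" if "C \<circ>\<^sub>p [:of_int s, 1:] dvd 1" for C :: "rat poly"
  proof -
    have "C \<noteq> 0" using that by auto
    moreover have "degree C = 0"
      using that is_unit_iff_degree[of "C \<circ>\<^sub>p [:of_int s, 1:]"] by (force simp: degree_pcompose)
    ultimately show ?thesis by (simp add: is_unit_iff_degree)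
  qed
  ultimately show "A dvd 1 \<or> B dvd 1" by blast
qed

text \<open>
  Schoenemann's form of the criterion: modulo \<open>l\<close> the polynomial is a constant times a power of \<open>x - s\<close>,
  and the substitution of \<open>x + s\<close> for \<open>x\<close> turns its value at \<open>s\<close> into the constant coefficient.
\<close>
lemma eisenstein_shifted:
  fixes P R :: "int poly" and l s c :: int
  assumes "prime l" "n > 0" "degree P = n" and P: "P = smult c ([:-s, 1:] ^ n) + smult l R"
    and c: "\<not> l dvd c" and const: "\<not> l\<^sup>2 dvd poly P s"
  shows "irreducible_over_rat P"
proof (rule irreducible_over_rat_shift[of P s])
  let ?Q = "P \<circ>\<^sub>p [:s, 1:]"
  have pow: "[:-s, 1:] ^ m \<circ>\<^sub>p [:s, 1:] = monom 1 m" for m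
  proof (induction m)
    case (Suc m)
    have "[:-s, 1:] \<circ>\<^sub>p [:s, 1:] = [:0, 1:]" by (simp add: pcompose_pCons)
    then show ?case by (simp only: power_Suc pcompose_mult Suc) (simp add: monom_Suc)
  qed (simp add: pcompose_1)
  have Q: "?Q = monom c n + smult l (R \<circ>\<^sub>p [:s, 1:])"
    by (simp add: P pcompose_add pcompose_smult pow smult_monom)
  have deg: "degree ?Q = n"
    using assms(3) by (simp add: degree_pcompose)
  show "irreducible_over_rat ?Q"
  proof (rule eisenstein[OF assms(1)])
    show "degree ?Q > 0" using deg assms(2) by simp
    show "\<not> l dvd lead_coeff ?Q"
      unfolding deg using c by (simp add: Q dvd_add_left_iff)
    show "l dvd coeff ?Q i" if "i < degree ?Q" for i
      using that unfolding deg by (simp add: Q)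
    show "\<not> l\<^sup>2 dvd coeff ?Q 0"
      using const by (simp flip: poly_0_coeff_0 add: poly_pcompose)
  qed
qed

section \<open>The minimal polynomial over the integers\<close>

text \<open>
  If the polynomials were coprime over the rationals, a Bezout identity evaluated at the common root would
  give \<open>1 = 0\<close>.
\<close>
lemma common_root_associated:
  fixes p q :: "int poly" and x :: complex
  assumes p: "irreducible_over_rat p" "poly (map_poly of_int p) x = 0"
    and q: "irreducible_over_rat q" "poly (map_poly of_int q) x = 0" "content q = 1"
  shows "\<exists>c. p = smult c q"
proof -
  define ev where "ev = (\<lambda>r :: rat poly. poly (map_poly of_rat r) x)"
  have ev_add: "ev (r + s) = ev r + ev s" for r s
    unfolding ev_def poly_add[symmetric]
    by (rule arg_cong[where f = "\<lambda>t. poly t x"], intro poly_eqI) (simp add: coeff_map_poly of_rat_add)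
  have ev_mult: "ev (r * s) = ev r * ev s" for r s
    unfolding ev_def poly_mult[symmetric]
    by (rule arg_cong[where f = "\<lambda>t. poly t x"], intro poly_eqI)
      (simp add: coeff_map_poly coeff_mult of_rat_sum of_rat_mult)
  have ev_int: "ev (map_poly of_int r) = poly (map_poly of_int r) x" for r
    unfolding ev_def by (rule arg_cong[where f = "\<lambda>t. poly t x"], intro poly_eqI) (simp add: coeff_map_poly)
  let ?p = "map_poly rat_of_int p" and ?q = "map_poly rat_of_int q"
  have irr: "irreducible ?p" "irreducible ?q"
    using p q by (simp_all add: irreducible_over_rat_def)
  have "\<not> coprime ?p ?q"
  proof
    assume "coprime ?p ?q"
    then obtain u v where "u * ?p + v * ?q = 1"
      using bezout_coefficients_fst_snd[of ?p ?q] by (metis coprime_iff_gcd_eq_1)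
    then have "ev 1 = ev u * ev ?p + ev v * ev ?q"
      by (simp flip: ev_add ev_mult)
    then have "ev 1 = 0"
      using p q by (simp add: ev_int)
    then show False by (simp add: ev_def)
  qed
  then have "?q dvd ?p"
    using prime_elem_imp_coprime[OF field_poly_irreducible_imp_prime[OF irr(2)], of ?p]
    by (auto simp: coprime_commute)
  then obtain r where r: "?p = ?q * r" by blast
  then have "r dvd 1"
    using irreducibleD[OF irr(1) r] irreducible_not_unit[OF irr(2)] by blast
  then obtain c where "r = [:c:]" by (auto simp: is_unit_poly_iff)
  then have "?p = smult c ?q" using r by simp
  then show ?thesis using primitive_rat_associated q(3) by blast
qed

text \<open>
  The primitive part with the sign adjusted satisfies the description that defines \<^const>\<open>int_min_poly\<close>, and
  by the previous lemma nothing else does. Hence degree and roots of the minimal polynomial can be read off any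
  irreducible integer polynomial with the given root, whose coefficients also bound the height.
\<close>
lemma int_min_poly_multiple:
  fixes p :: "int poly" and x :: complex
  assumes "irreducible_over_rat p" "poly (map_poly of_int p) x = 0"
  shows "\<exists>c. c \<noteq> 0 \<and> p = smult c (int_min_poly x)"
proof -
  have irr_smult: "irreducible_over_rat (smult c r) \<longleftrightarrow> irreducible_over_rat r" if "c \<noteq> 0" for c r
  proof -
    have "map_poly rat_of_int (smult c r) = [:of_int c:] * map_poly rat_of_int r"
      by (simp add: map_poly_of_int_smult)
    moreover have "[:rat_of_int c:] dvd 1" using that by (simp add: is_unit_poly_iff dvd_field_iff)
    ultimately show ?thesis
      unfolding irreducible_over_rat_def by (simp only: irreducible_mult_unit_left)
  qed
  have "p \<noteq> 0" using assms(1) by (auto simp: irreducible_over_rat_def)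
  define c where "c = sgn (lead_coeff p) * content p"
  define r where "r = smult (sgn (lead_coeff p)) (primitive_part p)"
  have c: "c \<noteq> 0" using \<open>p \<noteq> 0\<close> by (simp add: c_def sgn_eq_0_iff)
  have pr: "p = smult c r"
    using \<open>p \<noteq> 0\<close> by (simp add: c_def r_def sgn_if)
  have cont: "content r = 1"
    using \<open>p \<noteq> 0\<close> by (simp add: r_def content_smult)
  have "lead_coeff p = content p * lead_coeff (primitive_part p)"
    using lead_coeff_smult[of "content p" "primitive_part p"] by simp
  then have "content p * lead_coeff r = sgn (lead_coeff p) * lead_coeff p"
    by (simp add: r_def)
  also have "\<dots> = \<bar>lead_coeff p\<bar>"
    by (simp add: abs_sgn[of "lead_coeff p"])
  also have "\<dots> > 0"
    using \<open>p \<noteq> 0\<close> by simp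
  finally have "content p * lead_coeff r > 0" .
  moreover have "content p > 0"
  proof -
    have "content p \<noteq> 0" using \<open>p \<noteq> 0\<close> by simp
    moreover have "\<bar>content p\<bar> = content p" using normalize_content[of p] by simp
    ultimately show ?thesis by linarith
  qed
  ultimately have "lead_coeff r > 0" by (rule zero_less_mult_pos)
  moreover have "irreducible_over_rat r"
    using assms(1) c by (simp add: pr irr_smult)
  moreover have "poly (map_poly of_int r) x = 0"
    using assms(2) c by (simp add: pr map_poly_of_int_smult)
  ultimately have ex: "content r = 1 \<and> irreducible_over_rat r \<and> lead_coeff r > 0 \<and> poly (map_poly of_int r) x = 0"
    using cont by blast
  have "int_min_poly x = r"
    unfolding int_min_poly_def
  proof (rule the_equality)
    fix r' assume r': "content r' = 1 \<and> irreducible_over_rat r' \<and> lead_coeff r' > 0 \<and> poly (map_poly of_int r') x = 0"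
    then obtain e where e: "r' = smult e r"
      using common_root_associated ex by blast
    have "\<bar>e\<bar> = 1" using r' ex by (simp add: e content_smult)
    moreover have "e > 0" using r' ex by (auto simp: e zero_less_mult_iff split: if_splits)
    ultimately show "r' = r" by (simp add: e)
  qed (fact ex)
  then show ?thesis using c pr by blast
qed

section \<open>From close roots to separation exponents\<close>

lemma finite_int_polys_bounded:
  "finite {q :: int poly. degree q \<le> n \<and> (\<forall>i. \<bar>coeff q i\<bar> \<le> H)}"
proof (rule finite_subset)
  show "{q :: int poly. degree q \<le> n \<and> (\<forall>i. \<bar>coeff q i\<bar> \<le> H)}
      \<subseteq> Poly ` {xs. set xs \<subseteq> {-H..H} \<and> length xs \<le> n + 1}"
  proof
    fix q :: "int poly" assume q: "q \<in> {q. degree q \<le> n \<and> (\<forall>i. \<bar>coeff q i\<bar> \<le> H)}"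
    have "set (coeffs q) \<subseteq> {-H..H}"
    proof
      fix c assume "c \<in> set (coeffs q)"
      then obtain i where "c = coeff q i" by (auto simp: coeffs_def split: if_splits)
      then have "\<bar>c\<bar> \<le> H" using q by simp
      then show "c \<in> {-H..H}" by (simp add: abs_le_iff)
    qed
    moreover have "length (coeffs q) \<le> n + 1"
      using q by (cases "q = 0") (simp_all add: length_coeffs_degree)
    ultimately show "q \<in> Poly ` {xs. set xs \<subseteq> {-H..H} \<and> length xs \<le> n + 1}"
      by (intro image_eqI[of _ _ "coeffs q"]) simp_all
  qed
  show "finite (Poly ` {xs. set xs \<subseteq> {-H..H} \<and> length xs \<le> n + 1})"
    by (intro finite_imageI finite_lists_length_le) simp
qed

text \<open>
  Only finitely many polynomials are involved, hence only finitely many distances between distinct roots.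
  A family whose roots come arbitrarily close must therefore have unbounded height.
\<close>
lemma bounded_height_roots_separated:
  "\<exists>\<delta>>0. \<forall>q :: int poly. \<forall>x y :: complex. q \<noteq> 0 \<longrightarrow> degree q \<le> n \<longrightarrow> (\<forall>i. \<bar>coeff q i\<bar> \<le> H) \<longrightarrow>
      poly (map_poly of_int q) x = 0 \<longrightarrow> poly (map_poly of_int q) y = 0 \<longrightarrow> x \<noteq> y \<longrightarrow> \<delta> \<le> cmod (x - y)"
proof -
  define S where "S = {q :: int poly. degree q \<le> n \<and> (\<forall>i. \<bar>coeff q i\<bar> \<le> H)} - {0}"
  define Z where "Z = (\<lambda>q :: int poly. {x :: complex. poly (map_poly of_int q) x = 0})"
  define D where "D = (\<Union>q\<in>S. (\<lambda>(x, y). cmod (x - y)) ` (Z q \<times> Z q)) - {0}"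
  have "finite (Z q)" if "q \<in> S" for q
    unfolding Z_def using that by (intro poly_roots_finite) (simp add: S_def map_poly_of_int_eq_0_iff)
  moreover have "finite S"
    unfolding S_def using finite_int_polys_bounded by blast
  ultimately have fin: "finite D"
    unfolding D_def by blast
  define \<delta> where "\<delta> = Min (insert 1 D)"
  have "\<forall>d\<in>insert 1 D. d > 0" by (auto simp: D_def)
  then have "\<delta> > 0" using fin by (simp add: \<delta>_def)
  moreover have "\<delta> \<le> cmod (x - y)"
    if "q \<noteq> 0" "degree q \<le> n" "\<forall>i. \<bar>coeff q i\<bar> \<le> H" "poly (map_poly of_int q) x = 0"
      "poly (map_poly of_int q) y = 0" "x \<noteq> y" for q :: "int poly" and x y
  proof -
    have "q \<in> S" "(x, y) \<in> Z q \<times> Z q" using that by (simp_all add: S_def Z_def)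
    then have "cmod (x - y) \<in> D" using \<open>x \<noteq> y\<close> unfolding D_def by force
    then show ?thesis unfolding \<delta>_def using fin by simp
  qed
  ultimately show ?thesis by blast
qed

text \<open>
  The parameter \<open>u\<close> is the growth rate of the coefficients and \<open>v\<close> the rate at which two roots approach each
  other. The parameter \<open>b\<close> is real because the cubic family below is naturally expressed in terms of a
  square root. The predicate \<open>\<Phi>\<close> is used to demand monic polynomials.
\<close>
definition close_root_family :: "(int poly \<Rightarrow> bool) \<Rightarrow> nat \<Rightarrow> nat \<Rightarrow> nat \<Rightarrow> bool" where
  "close_root_family \<Phi> n u v \<longleftrightarrow>
     (\<exists>K C :: real. \<forall>B. \<exists>b\<ge>B. \<exists>P :: int poly. \<exists>x y :: real.
        \<Phi> P \<and> irreducible_over_rat P \<and> degree P = n \<and> (\<forall>i. real_of_int \<bar>coeff P i\<bar> \<le> K * b ^ u)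
        \<and> poly (map_poly of_int P) x = 0 \<and> poly (map_poly of_int P) y = 0
        \<and> x \<noteq> y \<and> \<bar>x - y\<bar> \<le> C / b ^ v)"

lemma poly_of_int_of_real:
  "poly (map_poly of_int P) (complex_of_real x) = complex_of_real (poly (map_poly of_int P) x)"
  by (induction P) (simp_all add: map_poly_of_int_pCons)

lemma abs_coeff_le_alg_height:
  assumes "int_min_poly x \<noteq> 0"
  shows "\<bar>coeff (int_min_poly x) i\<bar> \<le> alg_height x"
proof (cases "i \<le> degree (int_min_poly x)")
  case True
  then show ?thesis
    unfolding alg_height_def using assms
    by (intro Max_ge imageI) (auto simp: coeff_in_coeffs)
next
  case False
  have "lead_coeff (int_min_poly x) \<in> set (coeffs (int_min_poly x))"
    using assms by (simp add: coeff_in_coeffs)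
  then have "\<bar>lead_coeff (int_min_poly x)\<bar> \<le> alg_height x"
    unfolding alg_height_def by (intro Max_ge imageI) auto
  then show ?thesis using False by (simp add: coeff_eq_0)
qed

lemma alg_height_attained:
  assumes "int_min_poly x \<noteq> 0"
  obtains i where "alg_height x = \<bar>coeff (int_min_poly x) i\<bar>"
proof -
  have "alg_height x \<in> abs ` set (coeffs (int_min_poly x))"
    unfolding alg_height_def using assms by (intro Max_in) auto
  then show ?thesis
    using that by (auto simp: coeffs_def split: if_splits)
qed

text \<open>
  Suppose \<open>\<kappa> < e = v / u\<close> were admissible. Let \<open>H\<close> be the height of a root in the family. From \<open>H \<le> K b^u\<close> it
  follows that \<open>b^v \<ge> (H / K)^e\<close>, so the two roots are at most \<open>C K^e H^(-e)\<close> apart. This is at most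
  \<open>H^(-\<kappa>)\<close> once \<open>H\<close> is large, and \<open>H\<close> is large as soon as the roots are close enough.
\<close>
lemma close_root_family_exponent:
  assumes fam: "close_root_family \<Phi> n u v" and "u > 0" "v > 0"
    and A: "\<And>P x. \<Phi> P \<Longrightarrow> P \<noteq> 0 \<Longrightarrow> poly (map_poly of_int P) x = 0 \<Longrightarrow> x \<in> A"
  shows "ereal (real v / real u) \<le> (INF \<kappa>\<in>root_separation_exponents A n. ereal \<kappa>)"
proof (rule INF_greatest, rule ccontr)
  fix \<kappa> assume \<kappa>: "\<kappa> \<in> root_separation_exponents A n" "\<not> ereal (real v / real u) \<le> ereal \<kappa>"
  define e where "e = real v / real u"
  have e: "e > 0" "\<kappa> < e" using \<kappa>(2) assms by (simp_all add: e_def)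
  obtain H0 where H0: "\<And>x y. x \<in> A \<Longrightarrow> y \<in> A \<Longrightarrow> conjugate_over_rat x y \<Longrightarrow> x \<noteq> y \<Longrightarrow>
      alg_degree x = n \<Longrightarrow> alg_height x \<ge> H0 \<Longrightarrow> cmod (x - y) > real_of_int (alg_height x) powr (-\<kappa>)"
    using \<kappa>(1) unfolding root_separation_exponents_def by blast
  obtain K0 C0 where fam': "\<And>B. \<exists>b\<ge>B. \<exists>P :: int poly. \<exists>x y :: real.
        \<Phi> P \<and> irreducible_over_rat P \<and> degree P = n \<and> (\<forall>i. real_of_int \<bar>coeff P i\<bar> \<le> K0 * b ^ u)
        \<and> poly (map_poly of_int P) x = 0 \<and> poly (map_poly of_int P) y = 0
        \<and> x \<noteq> y \<and> \<bar>x - y\<bar> \<le> C0 / b ^ v"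
    using fam unfolding close_root_family_def by blast
  define K C where "K = max K0 1" and "C = max C0 1"
  have KC: "K \<ge> 1" "C \<ge> 1" "K0 \<le> K" "C0 \<le> C" by (simp_all add: K_def C_def)
  \<comment> \<open>The height from which on \<open>C K^e H^(-e) \<le> H^(-\<kappa>)\<close>.\<close>
  define M where "M = (C * K powr e) powr (1 / (e - \<kappa>))"
  define H1 where "H1 = max (max H0 \<lceil>M\<rceil>) 1"
  obtain \<delta> where \<delta>: "\<delta> > 0" "\<And>q x y. q \<noteq> 0 \<Longrightarrow> degree q \<le> n \<Longrightarrow> (\<And>i. \<bar>coeff q i\<bar> \<le> H1) \<Longrightarrow>
      poly (map_poly of_int q) x = 0 \<Longrightarrow> poly (map_poly of_int q) (y :: complex) = 0 \<Longrightarrow> x \<noteq> y \<Longrightarrow> \<delta> \<le> cmod (x - y)"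
    using bounded_height_roots_separated[of n H1] by blast
  obtain b P x y where b: "b \<ge> 1 + C / \<delta>" and P: "\<Phi> P" "irreducible_over_rat P" "degree P = n"
      "\<And>i. real_of_int \<bar>coeff P i\<bar> \<le> K0 * b ^ u" and roots: "poly (map_poly of_int P) (x::real) = 0"
      "poly (map_poly of_int P) y = 0" "x \<noteq> y" "\<bar>x - y\<bar> \<le> C0 / b ^ v"
    using fam'[of "1 + C / \<delta>"] by blast
  have b1: "b \<ge> 1" using b KC \<delta> by (smt (verit) divide_nonneg_pos)
  have close: "\<bar>x - y\<bar> \<le> C / b ^ v"
    using roots(4) KC(4) b1 by (smt (verit) divide_right_mono zero_le_power)
  have "C / b ^ v \<le> C / b"
    using b1 KC \<open>v > 0\<close> self_le_power[of b v] by (intro divide_left_mono) auto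
  also have "\<dots> < \<delta>"
  proof -
    have "C / \<delta> < b" using b by simp
    then show ?thesis using \<delta>(1) b1 by (simp add: field_simps)
  qed
  finally have "\<bar>x - y\<bar> < \<delta>" using close by linarith
  define x' y' where "x' = complex_of_real x" and "y' = complex_of_real y"
  have dist: "cmod (x' - y') = \<bar>x - y\<bar>"
    by (simp add: x'_def y'_def flip: of_real_diff)
  have roots': "poly (map_poly of_int P) x' = 0" "poly (map_poly of_int P) y' = 0" "x' \<noteq> y'"
    using roots by (simp_all add: x'_def y'_def poly_of_int_of_real)
  define q where "q = int_min_poly x'"
  obtain c where c: "c \<noteq> 0" "P = smult c q"
    using int_min_poly_multiple[OF P(2) roots'(1)] unfolding q_def by blast
  have "P \<noteq> 0" using P(2) by (auto simp: irreducible_over_rat_def)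
  then have "q \<noteq> 0" using c by auto
  have qroots: "poly (map_poly of_int q) x' = 0" "poly (map_poly of_int q) y' = 0"
    using roots' c by (simp_all add: map_poly_of_int_smult)
  have degq: "degree q = n" using P(3) c by simp
  define H where "H = alg_height x'"
  have "H > H1"
  proof (rule ccontr)
    assume "\<not> H > H1"
    then have "\<bar>coeff q i\<bar> \<le> H1" for i
      using abs_coeff_le_alg_height[of x' i] \<open>q \<noteq> 0\<close> by (simp add: q_def H_def)
    then have "\<delta> \<le> cmod (x' - y')"
      using \<delta>(2)[of q x' y'] \<open>q \<noteq> 0\<close> degq qroots roots'(3) by simp
    then show False using \<open>\<bar>x - y\<bar> < \<delta>\<close> dist by simp
  qed
  then have "H \<ge> H0" "H \<ge> \<lceil>M\<rceil>" "H > 1"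
    by (auto simp: H1_def)
  then have H: "H \<ge> H0" "real_of_int H \<ge> M" "real_of_int H > 1"
    by (simp_all add: ceiling_le_iff)
  obtain i where "H = \<bar>coeff q i\<bar>"
    using alg_height_attained \<open>q \<noteq> 0\<close> unfolding q_def H_def by blast
  also have "\<dots> \<le> \<bar>coeff P i\<bar>"
  proof -
    have "1 \<le> \<bar>c\<bar>" using c(1) by linarith
    then have "1 * \<bar>coeff q i\<bar> \<le> \<bar>c\<bar> * \<bar>coeff q i\<bar>" by (intro mult_right_mono) auto
    then show ?thesis using c(2) by (simp add: abs_mult)
  qed
  finally have "real_of_int H \<le> real_of_int \<bar>coeff P i\<bar>" by linarith
  also have "\<dots> \<le> K * b ^ u"
    using P(4)[of i] KC b1 by (smt (verit) mult_right_mono zero_le_power)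
  finally have "real_of_int H / K \<le> b ^ u"
    using KC by (simp add: field_simps)
  then have "(real_of_int H / K) powr e \<le> (b ^ u) powr e"
    using e H KC by (intro powr_mono2) auto
  also have "\<dots> = b ^ v"
    using b1 \<open>u > 0\<close> by (simp add: e_def powr_powr flip: powr_realpow)
  finally have "C / b ^ v \<le> C / (real_of_int H / K) powr e"
    using KC H b1 by (intro divide_left_mono) auto
  also have "\<dots> = (C * K powr e) * real_of_int H powr (-e)"
    using KC H by (simp add: powr_divide powr_minus field_simps)
  also have "\<dots> \<le> real_of_int H powr (e - \<kappa>) * real_of_int H powr (-e)"
  proof (rule mult_right_mono)
    have "C * K powr e = M powr (e - \<kappa>)"
      using e KC by (simp add: M_def powr_powr)
    also have "\<dots> \<le> real_of_int H powr (e - \<kappa>)"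
      using e H by (intro powr_mono2) (auto simp: M_def)
    finally show "C * K powr e \<le> real_of_int H powr (e - \<kappa>)" .
  qed auto
  also have "\<dots> = real_of_int H powr (-\<kappa>)"
    by (simp flip: powr_add)
  finally have "cmod (x' - y') \<le> real_of_int H powr (-\<kappa>)"
    using close dist by linarith
  moreover have "cmod (x' - y') > real_of_int H powr (-\<kappa>)"
    unfolding H_def
  proof (rule H0)
    show "x' \<in> A" "y' \<in> A" using A P(1) \<open>P \<noteq> 0\<close> roots' by blast+
    show "conjugate_over_rat x' y'"
      unfolding conjugate_over_rat_def using P(2) roots' by blast
    show "alg_degree x' = n" using degq by (simp add: alg_degree_def q_def)
  qed (use roots' H in \<open>simp_all add: H_def\<close>)
  ultimately show False by simp
qed

lemma kappa_ge:
  assumes "close_root_family \<Phi> n u v" "u > 0" "v > 0"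
  shows "ereal (real v / real u) \<le> kappa n"
  unfolding kappa_def
proof (rule close_root_family_exponent[OF assms])
  fix P and x :: complex assume "P \<noteq> 0" "poly (map_poly of_int P) x = 0"
  then show "x \<in> {\<alpha>. algebraic \<alpha>}"
    by (intro CollectI algebraicI[of "map_poly of_int P"]) (auto simp: coeff_map_poly map_poly_of_int_eq_0_iff)
qed

lemma kappa_star_ge:
  assumes "close_root_family (\<lambda>P. lead_coeff P = 1) n u v" "u > 0" "v > 0"
  shows "ereal (real v / real u) \<le> kappa_star n"
  unfolding kappa_star_def
proof (rule close_root_family_exponent[OF assms])
  fix P and x :: complex assume "lead_coeff P = 1" "poly (map_poly of_int P) x = 0"
  then show "x \<in> {\<alpha>. algebraic_int \<alpha>}"
    by (intro CollectI algebraic_int.intros[of "map_poly of_int P"])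
      (auto simp: coeff_map_poly degree_map_poly_of_int)
qed

section \<open>Sign changes and coefficient bounds\<close>

text \<open>
  The roots of the families below are located by the intermediate value theorem: the sign at \<open>\<xi>\<close> differs
  from the signs at both \<open>\<xi> - \<delta>\<close> and \<open>\<xi> + \<delta>\<close>.
\<close>
lemma two_real_roots_if_sign_changes:
  fixes p :: "real poly"
  assumes "\<delta> > 0" "poly p \<xi> * poly p (\<xi> - \<delta>) < 0" "poly p \<xi> * poly p (\<xi> + \<delta>) < 0"
  shows "\<exists>x y. poly p x = 0 \<and> poly p y = 0 \<and> x \<noteq> y \<and> \<bar>x - y\<bar> \<le> 2 * \<delta>"
proof -
  obtain x where x: "\<xi> - \<delta> < x" "x < \<xi>" "poly p x = 0"
    using poly_IVT[of "\<xi> - \<delta>" \<xi> p] assms by (auto simp: mult.commute)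
  obtain y where y: "\<xi> < y" "y < \<xi> + \<delta>" "poly p y = 0"
    using poly_IVT[of \<xi> "\<xi> + \<delta>" p] assms by auto
  show ?thesis using x y by (intro exI[of _ x] exI[of _ y]) auto
qed

lemma coeff_bounded_poly:
  fixes p :: "int poly"
  shows "\<exists>M. \<forall>i. \<bar>coeff p i\<bar> \<le> M"
proof (intro exI allI)
  fix i
  show "\<bar>coeff p i\<bar> \<le> (\<Sum>i\<le>degree p. \<bar>coeff p i\<bar>)"
  proof (cases "i \<le> degree p")
    case True
    then show ?thesis by (intro member_le_sum[of i _ "\<lambda>i. \<bar>coeff p i\<bar>"]) auto
  next
    case False
    then show ?thesis by (simp add: coeff_eq_0 sum_nonneg)
  qed
qed

lemma coeff_bound_quadratic:
  fixes U V W :: "int poly"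
  shows "\<exists>K. \<forall>a\<ge>1. \<forall>i. \<bar>coeff (U + smult a V + smult (a\<^sup>2) W) i\<bar> \<le> K * a\<^sup>2"
proof -
  obtain MU MV MW where M: "\<And>i. \<bar>coeff U i\<bar> \<le> MU" "\<And>i. \<bar>coeff V i\<bar> \<le> MV" "\<And>i. \<bar>coeff W i\<bar> \<le> MW"
    using coeff_bounded_poly by metis
  have "\<bar>coeff (U + smult a V + smult (a\<^sup>2) W) i\<bar> \<le> (MU + MV + MW) * a\<^sup>2" if a: "a \<ge> 1" for a i
  proof -
    have a2: "1 \<le> a\<^sup>2" "a \<le> a\<^sup>2" using a by (simp_all add: self_le_power)
    have "\<bar>coeff U i\<bar> * 1 \<le> MU * a\<^sup>2" using M(1)[of i] a2 by (intro mult_mono) auto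
    moreover have "\<bar>coeff V i\<bar> * a \<le> MV * a\<^sup>2" using M(2)[of i] a2 a by (intro mult_mono) auto
    moreover have "\<bar>coeff W i\<bar> * a\<^sup>2 \<le> MW * a\<^sup>2" using M(3)[of i] by (intro mult_right_mono) auto
    moreover have "\<bar>coeff U i + a * coeff V i + a\<^sup>2 * coeff W i\<bar>
        \<le> \<bar>coeff U i\<bar> + \<bar>a * coeff V i\<bar> + \<bar>a\<^sup>2 * coeff W i\<bar>"
      by linarith
    moreover have "\<bar>a * coeff V i\<bar> = \<bar>coeff V i\<bar> * a" "\<bar>a\<^sup>2 * coeff W i\<bar> = \<bar>coeff W i\<bar> * a\<^sup>2"
      using a by (simp_all add: abs_mult)
    ultimately show ?thesis unfolding distrib_right coeff_add coeff_smult by linarith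
  qed
  then show ?thesis by blast
qed

lemma smult_numeral: "smult (numeral w) p = numeral w * (p :: 'a::comm_semiring_1 poly)"
  by (simp add: numeral_poly)

text \<open>
  Even parameters suffice, and with them the congruence modulo \<open>2\<close> behind the irreducibility of the main
  family is available.
\<close>
lemma close_root_familyI:
  fixes Q :: "int \<Rightarrow> int poly" and K b\<^sub>0 :: int and C :: real
  assumes "\<And>b. b \<ge> b\<^sub>0 \<Longrightarrow> even b \<Longrightarrow> \<Phi> (Q b)"
    and "\<And>b. b \<ge> b\<^sub>0 \<Longrightarrow> even b \<Longrightarrow> irreducible_over_rat (Q b)"
    and "\<And>b. b \<ge> b\<^sub>0 \<Longrightarrow> even b \<Longrightarrow> degree (Q b) = n"
    and "\<And>b i. b \<ge> b\<^sub>0 \<Longrightarrow> even b \<Longrightarrow> \<bar>coeff (Q b) i\<bar> \<le> K * b ^ u"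
    and "\<And>b. b \<ge> b\<^sub>0 \<Longrightarrow> even b \<Longrightarrow> \<exists>x y :: real. poly (map_poly of_int (Q b)) x = 0
          \<and> poly (map_poly of_int (Q b)) y = 0 \<and> x \<noteq> y \<and> \<bar>x - y\<bar> \<le> C / of_int b ^ v"
  shows "close_root_family \<Phi> n u v"
  unfolding close_root_family_def
proof (rule exI[of _ "of_int K"], rule exI[of _ C], rule allI)
  fix B :: real
  define b where "b = 2 * max (max b\<^sub>0 \<lceil>B\<rceil>) 0"
  have "b \<ge> b\<^sub>0" "\<lceil>B\<rceil> \<le> b" "even b" by (auto simp: b_def)
  then have b: "b \<ge> b\<^sub>0" "B \<le> of_int b" "even b" by (simp_all add: ceiling_le_iff)
  have "real_of_int \<bar>coeff (Q b) i\<bar> \<le> of_int K * of_int b ^ u" for i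
    using assms(4)[OF b(1,3), of i] by (simp flip: of_int_power of_int_mult)
  then show "\<exists>b\<ge>B. \<exists>P :: int poly. \<exists>x y :: real. \<Phi> P \<and> irreducible_over_rat P \<and> degree P = n
      \<and> (\<forall>i. real_of_int \<bar>coeff P i\<bar> \<le> of_int K * b ^ u)
      \<and> poly (map_poly of_int P) x = 0 \<and> poly (map_poly of_int P) y = 0
      \<and> x \<noteq> y \<and> \<bar>x - y\<bar> \<le> C / b ^ v"
    using b assms(1-3,5)[OF b(1,3)] by blast
qed

section \<open>Mignotte's polynomials\<close>

text \<open>
  Near \<open>1 / a\<close> the term \<open>x^m\<close> is about \<open>a^(-m)\<close> and splits the double root of \<open>2 (a x - 1)^2\<close> into two roots
  at distance about \<open>a^(-(m+2)/2)\<close>.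
\<close>
definition mignotte_poly :: "nat \<Rightarrow> int \<Rightarrow> int poly" where
  "mignotte_poly m a = monom 1 m - smult 2 ([:-1, a:]\<^sup>2)"

lemma degree_mignotte:
  assumes "m \<ge> 2"
  shows "degree (mignotte_poly m a) = m"
proof (rule antisym)
  have d: "degree ([:-1, a:]\<^sup>2) \<le> 2"
    using degree_power_le[of "[:-1, a:]" 2] by (simp split: if_splits)
  then show "degree (mignotte_poly m a) \<le> m"
    unfolding mignotte_poly_def using assms
    by (intro degree_diff_le) (auto simp: degree_monom_le)
  have "odd (coeff (mignotte_poly m a) m)"
    by (simp add: mignotte_poly_def)
  then show "m \<le> degree (mignotte_poly m a)"
    by (intro le_degree) auto
qed

lemma irreducible_mignotte:
  assumes "m \<ge> 2"
  shows "irreducible_over_rat (mignotte_poly m a)"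
proof (rule eisenstein_shifted[where l = 2 and s = 0 and c = 1 and n = m and R = "- ([:-1, a:]\<^sup>2)"])
  show "mignotte_poly m a = smult 1 ([:- 0, 1:] ^ m) + smult 2 (- ([:-1, a:]\<^sup>2))"
    by (simp add: mignotte_poly_def monom_altdef)
  show "\<not> 2\<^sup>2 dvd poly (mignotte_poly m a) 0"
    using assms by (simp add: mignotte_poly_def poly_monom power_0_left)
qed (use assms degree_mignotte in simp_all)

lemma poly_mignotte:
  "poly (map_poly of_int (mignotte_poly m a)) (x :: real) = x ^ m - 2 * (of_int a * x - 1)\<^sup>2"
  by (simp add: mignotte_poly_def map_poly_of_int_simps poly_monom algebra_simps)

text \<open>
  The parameter \<open>a = b\<^sup>2\<close> is a square so that the distance is an integral power of \<open>b\<close>. At distance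
  \<open>\<delta> = 2^m / b^(m+2)\<close> from \<open>1 / a\<close> one has \<open>0 \<le> a x \<le> 2\<close>, hence \<open>x^m \<le> 2^m / a^m\<close>, whereas
  \<open>2 (a x - 1)^2 = 2 (a \<delta>)^2 = 2 \<cdot> 4^m / a^m\<close> is larger.
\<close>
lemma close_roots_mignotte:
  fixes b :: int
  assumes "m \<ge> 2" "b \<ge> 2"
  shows "\<exists>x y :: real. poly (map_poly of_int (mignotte_poly m (b\<^sup>2))) x = 0
      \<and> poly (map_poly of_int (mignotte_poly m (b\<^sup>2))) y = 0
      \<and> x \<noteq> y \<and> \<bar>x - y\<bar> \<le> 2 * (2 ^ m / of_int b ^ (m + 2))"
proof -
  let ?f = "map_poly of_int (mignotte_poly m (b\<^sup>2)) :: real poly"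
  define a where "a = (of_int b :: real)\<^sup>2"
  define \<delta> where "\<delta> = 2 ^ m / (of_int b :: real) ^ (m + 2)"
  have b: "(of_int b :: real) \<ge> 2" using assms(2) by linarith
  have a: "a > 0" using b by (simp add: a_def)
  have \<delta>: "\<delta> > 0" using b by (simp add: \<delta>_def)
  have a\<delta>: "a * \<delta> = (2 / of_int b) ^ m"
    using b by (simp add: a_def \<delta>_def power_add power_divide power2_eq_square)
  have a\<delta>1: "a * \<delta> \<le> 1"
    unfolding a\<delta> using b by (intro power_le_one) auto
  have f: "poly ?f x = x ^ m - 2 * (a * x - 1)\<^sup>2" for x
    by (simp add: poly_mignotte a_def)
  have pos: "poly ?f (1 / a) > 0" using a by (simp add: f)
  have neg: "poly ?f x < 0" if x: "\<bar>x - 1 / a\<bar> = \<delta>" for x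
  proof -
    have d: "\<bar>a * x - 1\<bar> = a * \<delta>"
      unfolding x[symmetric] using a by (simp add: abs_mult_pos' field_simps)
    then have "0 \<le> a * x" "a * x \<le> 2" using a\<delta>1 by linarith+
    then have "(a * x) ^ m \<le> 2 ^ m" by (intro power_mono)
    then have "x ^ m \<le> 2 ^ m / a ^ m" using a by (simp add: power_mult_distrib field_simps)
    also have "\<dots> < 2 * (2 ^ m / a ^ m) * 2 ^ m" 
    proof -
      have "0 < 2 ^ m / a ^ m" using a by simp
      moreover have "2 ^ m / a ^ m * 1 \<le> 2 ^ m / a ^ m * 2 ^ m"
        using a by (intro mult_left_mono) auto
      ultimately show ?thesis by linarith
    qed
    also have "\<dots> = 2 * (a * x - 1)\<^sup>2"
    proof -
      have "(a * x - 1)\<^sup>2 = (a * \<delta>)\<^sup>2" using d by (metis power2_abs)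
      also have "\<dots> = 2 ^ m / a ^ m * 2 ^ m"
        unfolding a\<delta> by (simp add: a_def power_divide power2_eq_square power_mult_distrib)
      finally show ?thesis by simp
    qed
    finally show ?thesis by (simp add: f)
  qed
  have "poly ?f (1 / a) * poly ?f (1 / a - \<delta>) < 0" "poly ?f (1 / a) * poly ?f (1 / a + \<delta>) < 0"
    using pos neg[of "1 / a - \<delta>"] neg[of "1 / a + \<delta>"] \<delta> by (simp_all add: mult_pos_neg)
  then show ?thesis
    using two_real_roots_if_sign_changes[OF \<delta>] unfolding \<delta>_def by blast
qed

lemma mignotte_family:
  assumes "m \<ge> 2" and \<Phi>: "\<And>a. \<Phi> (mignotte_poly m a)"
  shows "close_root_family \<Phi> m 4 (m + 2)"
proof -
  have "mignotte_poly m a = (monom 1 m - 2) + smult a [:0, 4:] + smult (a\<^sup>2) [:0, 0, -2:]" for a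
    by (simp add: mignotte_poly_def power2_eq_square numeral_poly)
  then obtain K where K: "\<And>a i. a \<ge> 1 \<Longrightarrow> \<bar>coeff (mignotte_poly m a) i\<bar> \<le> K * a\<^sup>2"
    using coeff_bound_quadratic[of "monom 1 m - 2" "[:0, 4:]" "[:0, 0, -2:]"] by auto
  show ?thesis
  proof (rule close_root_familyI[where b\<^sub>0 = 2 and Q = "\<lambda>b. mignotte_poly m (b\<^sup>2)" and C = "2 * 2 ^ m"])
    fix b :: int and i assume b: "b \<ge> 2"
    then have "1 \<le> b\<^sup>2" by (simp add: one_le_power)
    then show "\<bar>coeff (mignotte_poly m (b\<^sup>2)) i\<bar> \<le> K * b ^ 4"
      using K[of "b\<^sup>2" i] by (simp flip: power_mult)
  qed (use close_roots_mignotte irreducible_mignotte degree_mignotte assms in auto)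
qed

section \<open>A perturbed square\<close>

text \<open>
  The name refers to the two graphs \<open>(x + 1)^d (x^k - a x + 1)^2\<close> and \<open>2 x^j (a x - 1)^2\<close>: near \<open>1 / a\<close> the first
  one touches zero where the second one is almost zero.
\<close>
definition tangent_poly :: "nat \<Rightarrow> nat \<Rightarrow> nat \<Rightarrow> int \<Rightarrow> int poly" where
  "tangent_poly d k j a =
     [:1, 1:] ^ d * (monom 1 k + [:1, -a:])\<^sup>2 - smult 2 (monom 1 j * [:-1, a:]\<^sup>2)"

lemma frobenius_mod_2:
  "\<exists>S :: int poly. monom 1 (2 ^ e) + 1 = [:1, 1:] ^ (2 ^ e) + 2 * S"
proof (induction e)
  case 0
  have "monom 1 (2 ^ 0) + 1 = ([:1, 1:] ^ (2 ^ 0) :: int poly)"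
    by (simp add: monom_altdef one_pCons)
  then show ?case by (intro exI[of _ 0]) simp
next
  case (Suc e)
  define m x :: "int poly" where "m = monom 1 (2 ^ e)" and "x = [:1, 1:] ^ (2 ^ e)"
  obtain S where S: "m + 1 = x + 2 * S" using Suc.IH unfolding m_def x_def by blast
  have "monom 1 (2 ^ Suc e) = m * m"
    unfolding m_def mult_monom by (simp add: mult_2)
  then have "monom 1 (2 ^ Suc e) + 1 = (m + 1) * (m + 1) - 2 * m"
    by (simp add: algebra_simps)
  also have "\<dots> = x * x + 2 * (2 * (x * S) + 2 * (S * S) - m)"
    unfolding S by (simp add: algebra_simps)
  also have "x * x = [:1, 1:] ^ (2 ^ Suc e)"
    by (simp add: x_def mult_2 power_add)
  finally show ?case by blast
qed

text \<open>
  For even \<open>a\<close> the polynomial \<open>x^k - a x + 1\<close> is congruent to \<open>x^k + 1\<close> modulo \<open>2\<close>, and this is \<open>(x + 1)^k\<close>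
  because \<open>k\<close> is a power of \<open>2\<close>. This is the congruence which makes Eisenstein's criterion at \<open>-1\<close>
  applicable.
\<close>
lemma tangent_poly_mod_2:
  assumes "k = 2 ^ e" "even a"
  shows "\<exists>R. tangent_poly d k j a = [:1, 1:] ^ (d + 2 * k) + smult 2 R"
proof -
  define x y q z :: "int poly" where "x = [:1, 1:] ^ k" and "y = [:1, 1:] ^ d"
    and "q = [:-1, a:]\<^sup>2" and "z = monom 1 j"
  obtain S :: "int poly" where S: "monom 1 k + 1 = x + 2 * S"
    using frobenius_mod_2 assms(1) unfolding x_def by blast
  obtain c where c: "a = 2 * c" using assms(2) by blast
  define T where "T = S - smult c [:0, 1:]"
  have "monom 1 k + [:1, -a:] = (monom 1 k + 1) - 2 * smult c [:0, 1:]"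
    by (simp add: c one_pCons numeral_poly)
  then have p: "monom 1 k + [:1, -a:] = x + 2 * T"
    unfolding S T_def by (simp add: algebra_simps)
  have "tangent_poly d k j a = y * (x + 2 * T)\<^sup>2 - 2 * (z * q)"
    by (simp only: tangent_poly_def p smult_numeral y_def z_def q_def)
  also have "\<dots> = y * (x * x) + 2 * (y * (2 * (x * T) + 2 * (T * T)) - z * q)"
    by (simp add: power2_eq_square algebra_simps)
  also have "y * (x * x) = [:1, 1:] ^ (d + 2 * k)"
    by (simp only: x_def y_def mult_2 power_add)
  finally show ?thesis unfolding smult_numeral by blast
qed

lemma degree_tangent:
  assumes "k = 2 ^ e" "even a" "k > 0" "j + 2 \<le> d + 2 * k"
  shows "degree (tangent_poly d k j a) = d + 2 * k"
proof (rule antisym)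
  have "degree [:1, -a:] \<le> k" "degree [:-1, a:] \<le> 1" using assms(3) by auto
  then have p: "degree (monom 1 k + [:1, -a:]) \<le> k" 
    by (intro degree_add_le) (auto simp: degree_monom_le)
  have x: "degree ([:1, 1:] ^ d :: int poly) \<le> d"
    by (simp add: degree_linear_power)
  have p2: "degree ((monom 1 k + [:1, -a:])\<^sup>2) \<le> 2 * k"
    using degree_power_le[of "monom 1 k + [:1, -a:]" 2] p by linarith
  have q2: "degree ([:-1, a:]\<^sup>2) \<le> 2"
    using degree_power_le[of "[:-1, a:]" 2] \<open>degree [:-1, a:] \<le> 1\<close> by linarith
  show "degree (tangent_poly d k j a) \<le> d + 2 * k"
    unfolding tangent_poly_def
  proof (rule degree_diff_le)
    show "degree ([:1, 1:] ^ d * (monom 1 k + [:1, -a:])\<^sup>2) \<le> d + 2 * k"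
      using degree_mult_le[of "[:1, 1:] ^ d" "(monom 1 k + [:1, -a:])\<^sup>2"] x p2 by linarith
    have "degree (monom 1 j * [:-1, a:]\<^sup>2) \<le> j + 2"
      using degree_mult_le[of "monom 1 j" "[:-1, a:]\<^sup>2"] q2 degree_monom_le[of "1::int" j] by linarith
    then show "degree (smult 2 (monom 1 j * [:-1, a:]\<^sup>2)) \<le> d + 2 * k"
      using assms(4) by simp
  qed
  obtain R where "tangent_poly d k j a = [:1, 1:] ^ (d + 2 * k) + smult 2 R"
    using tangent_poly_mod_2[OF assms(1,2)] by blast
  then have "odd (coeff (tangent_poly d k j a) (d + 2 * k))"
    by (simp add: coeff_linear_power)
  then show "d + 2 * k \<le> degree (tangent_poly d k j a)"
    by (intro le_degree) auto
qed

lemma monic_tangent: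
  assumes "k = 2 ^ e" "even a" "k \<ge> 2" "j + 3 \<le> d + 2 * k"
  shows "lead_coeff (tangent_poly d k j a) = 1"
proof -
  have dp: "degree (monom 1 k + [:1, -a:]) = k"
    using assms(3) by (subst degree_add_eq_left) (auto simp: degree_monom_eq)
  have "coeff [:1, -a:] k = 0" using assms(3) by (intro coeff_eq_0) auto
  then have l: "lead_coeff (monom 1 k + [:1, -a:]) = 1"
    unfolding dp by simp
  then have nz: "monom 1 k + [:1, -a:] \<noteq> 0" by (metis coeff_0 zero_neq_one)
  have "degree ([:1, 1:] ^ d * (monom 1 k + [:1, -a:])\<^sup>2) = d + 2 * k"
    using nz by (subst degree_mult_eq) (simp_all add: degree_linear_power degree_power_eq dp)
  moreover have "lead_coeff ([:1, 1:] ^ d * (monom 1 k + [:1, -a:])\<^sup>2) = 1"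
    by (simp only: lead_coeff_mult lead_coeff_power l) simp
  ultimately have "coeff ([:1, 1:] ^ d * (monom 1 k + [:1, -a:])\<^sup>2) (d + 2 * k) = 1"
    by metis
  moreover have "coeff (monom 1 j * [:-1, a:]\<^sup>2) (d + 2 * k) = 0"
  proof (rule coeff_eq_0)
    have "degree ([:-1, a:]\<^sup>2) \<le> 2"
      using degree_power_le[of "[:-1, a:]" 2] by (simp split: if_splits)
    then show "degree (monom 1 j * [:-1, a:]\<^sup>2) < d + 2 * k"
      using degree_mult_le[of "monom 1 j" "[:-1, a:]\<^sup>2"] degree_monom_le[of "1::int" j] assms(4)
      by linarith
  qed
  moreover have "degree (tangent_poly d k j a) = d + 2 * k"
    using degree_tangent assms by simp
  ultimately show ?thesis by (simp add: tangent_poly_def)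
qed

text \<open>
  At \<open>-1\<close> the first summand of the polynomial is divisible by \<open>4\<close>: it vanishes if \<open>d > 0\<close>, and otherwise it
  is the square of the even number \<open>2 + a\<close>. The second summand is twice an odd number.
\<close>
lemma irreducible_tangent:
  assumes "k = 2 ^ e" "even a" "k \<ge> 2" "j + 2 \<le> d + 2 * k"
  shows "irreducible_over_rat (tangent_poly d k j a)"
proof -
  obtain R where R: "tangent_poly d k j a = [:1, 1:] ^ (d + 2 * k) + smult 2 R"
    using tangent_poly_mod_2[OF assms(1,2)] by blast
  have "even k" using assms by (cases e) auto
  obtain c where c: "a = 2 * c" using assms(2) by blast
  define w where "w = (if d = 0 then (c + 1)\<^sup>2 else 0)"
  define z where "z = (-1) ^ j * (2 * c + 1)\<^sup>2"
  have "odd z" by (simp add: z_def)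
  have "poly (tangent_poly d k j a) (-1) = 4 * w - 2 * z"
    using \<open>even k\<close>
    by (simp add: tangent_poly_def poly_monom c w_def z_def power_0_left power2_eq_square algebra_simps)
  moreover have "\<not> 4 dvd 4 * w - 2 * z" using \<open>odd z\<close> by presburger
  ultimately have "\<not> 2\<^sup>2 dvd poly (tangent_poly d k j a) (-1)" by simp
  then show ?thesis
    using assms R degree_tangent[OF assms(1,2) _ assms(4)]
    by (intro eisenstein_shifted[where l = 2 and s = "-1" and c = 1 and R = R and n = "d + 2 * k"]) auto
qed

lemma poly_tangent:
  "poly (map_poly of_int (tangent_poly d k j a)) (x :: real)
     = (1 + x) ^ d * (x ^ k + 1 - of_int a * x)\<^sup>2 - 2 * (x ^ j * (of_int a * x - 1)\<^sup>2)"
  by (simp add: tangent_poly_def map_poly_of_int_simps poly_monom) (simp add: algebra_simps)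

text \<open>
  Let \<open>a = b\<^sup>2\<close>, let \<open>g = x^k + 1 - a x\<close> with root \<open>\<xi>\<close> between \<open>1 / a\<close> and \<open>2 / a\<close>, and let \<open>\<delta>\<close> be the claimed
  distance without the factor \<open>2\<close>. At \<open>\<xi>\<close> only the negative summand survives. At \<open>\<xi> - \<delta>\<close> and \<open>\<xi> + \<delta>\<close> the
  linear term dominates \<open>g\<close>, so the first summand is at least \<open>(a \<delta> / 2)^2\<close>, while \<open>x \<le> 3 / a\<close> and
  \<open>\<bar>a x - 1\<bar> \<le> (2^k + 1) / a^k\<close> bound the second one. Both bounds are multiples of \<open>a^(-j-2k)\<close>, and
  \<open>C\<close> is chosen such that the first multiple is larger. The hypothesis \<open>j \<ge> 1\<close> ensures \<open>a \<delta> \<le> a^(-k)\<close>, so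
  that \<open>a x - 1\<close> is still as small as at \<open>\<xi>\<close>.
\<close>
lemma close_roots_tangent:
  fixes b :: int and k j :: nat
  defines "C \<equiv> 3 * 3 ^ j * (2 ^ k + 1)"
  assumes "k \<ge> 1" "j \<ge> 1" "b \<ge> C"
  shows "\<exists>x y :: real. poly (map_poly of_int (tangent_poly d k j (b\<^sup>2))) x = 0
      \<and> poly (map_poly of_int (tangent_poly d k j (b\<^sup>2))) y = 0
      \<and> x \<noteq> y \<and> \<bar>x - y\<bar> \<le> 2 * (of_int C / of_int b ^ (j + 2 * k + 2))"
proof -
  let ?f = "map_poly of_int (tangent_poly d k j (b\<^sup>2)) :: real poly"
  define \<beta> where "\<beta> = (of_int b :: real)"
  define c where "c = (of_int C :: real)"
  define a where "a = \<beta>\<^sup>2"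
  define \<delta> where "\<delta> = c / \<beta> ^ (j + 2 * k + 2)"
  have c: "c = 3 * 3 ^ j * (2 ^ k + 1)" by (simp add: c_def C_def)
  have "(1::real) \<le> 3 ^ j" by simp
  moreover have "real k + 1 \<le> 2 ^ k"
  proof -
    have "k + 1 \<le> 2 ^ k" using less_exp[of k] by (simp add: Suc_le_eq)
    then have "real (k + 1) \<le> real (2 ^ k)" by (simp only: of_nat_le_iff)
    then show ?thesis by simp
  qed
  \<comment> \<open>This crude bound makes \<open>a\<close> large enough for \<open>k \<delta> \<le> a \<delta> / 2\<close> and \<open>3 / a \<le> 1\<close>.\<close>
  ultimately have "3 * 1 * (real k + 2) \<le> c"
    unfolding c by (intro mult_mono) auto
  then have ck: "c \<ge> 3 * real k + 6" by simp
  have \<beta>: "\<beta> \<ge> c" using assms(4) by (simp add: \<beta>_def c_def)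
  then have \<beta>1: "\<beta> \<ge> 3 * real k + 6" "\<beta> \<ge> 1" "\<beta> > 0" using ck by linarith+
  have "\<beta> * 1 \<le> \<beta> * \<beta>" using \<beta>1 by (intro mult_left_mono) auto
  then have a: "a \<ge> 3 * real k + 6" "a > 0" using \<beta>1 unfolding a_def power2_eq_square by linarith+
  have \<delta>: "\<delta> > 0" using \<beta>1 ck by (simp add: \<delta>_def)
  have apow: "a ^ i = \<beta> ^ (2 * i)" for i by (simp add: a_def power_mult)
  have a\<delta>: "a * \<delta> = c / \<beta> ^ j / a ^ k"
    unfolding apow using \<beta>1 by (simp add: \<delta>_def power_add a_def field_simps power2_eq_square)
  have "c \<le> \<beta> ^ j" using \<beta> \<beta>1 self_le_power[of \<beta> j] assms(3) by linarith
  then have "c / \<beta> ^ j \<le> 1" using \<beta>1 by simp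
  then have a\<delta>1: "a * \<delta> \<le> 1 / a ^ k"
    unfolding a\<delta> using a by (intro divide_right_mono) auto
  have "1 \<le> a ^ k" using a by (intro one_le_power) linarith
  then have "1 / a ^ k \<le> 1" by simp
  then have a\<delta>2: "a * \<delta> \<le> 1" using a\<delta>1 by linarith

  define g where "g = (\<lambda>x :: real. x ^ k + 1 - a * x)"
  define p where "p = monom 1 k + [:1, -a:]"
  have gp: "poly p x = g x" for x by (simp add: p_def g_def poly_monom)
  have "g (1 / a) > 0" using a by (simp add: g_def)
  moreover have "g (2 / a) < 0"
  proof -
    have "(2 / a) ^ k \<le> (2 / a) ^ 1" using a assms(2) by (intro power_decreasing) auto
    then have "(2 / a) ^ k < 1" using a by (smt (verit) divide_less_eq_1_pos power_one_right of_nat_0_le_iff)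
    then show ?thesis using a by (simp add: g_def)
  qed
  ultimately obtain \<xi> where \<xi>: "1 / a < \<xi>" "\<xi> < 2 / a" "g \<xi> = 0"
    using poly_IVT_neg[of "1 / a" "2 / a" p] a by (auto simp: gp divide_strict_right_mono)
  have \<xi>0: "\<xi> > 0" using \<xi>(1) a by (smt (verit) divide_pos_pos)
  have \<xi>eq: "a * \<xi> - 1 = \<xi> ^ k" using \<xi>(3) by (simp add: g_def)
  have f: "poly ?f x = (1 + x) ^ d * (g x)\<^sup>2 - 2 * (x ^ j * (a * x - 1)\<^sup>2)" for x
    by (simp add: poly_tangent g_def a_def \<beta>_def)
  have neg: "poly ?f \<xi> < 0" using \<xi>(3) \<xi>0 by (simp add: f \<xi>eq)

  have pos: "poly ?f x > 0" if x: "\<bar>x - \<xi>\<bar> = \<delta>" for x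
  proof -
    have da: "\<delta> \<le> 1 / a" using a\<delta>2 a by (simp add: field_simps)
    have "x > 0" using x da \<xi>(1) by linarith
    have xa: "x \<le> 3 / a" using x da \<xi>(2) by (simp add: field_simps abs_if split: if_splits)
    have "3 / a \<le> 1" "2 / a \<le> 1" using a by simp_all
    then have x1: "x \<le> 1" "\<xi> \<le> 1" using xa \<xi>(2) by linarith+
    have "\<bar>x ^ k - \<xi> ^ k\<bar> \<le> real k * \<delta>"
      using norm_power_diff[of x \<xi> k] x1 \<open>x > 0\<close> \<xi>0 x by simp
    moreover have "\<bar>a * (x - \<xi>)\<bar> = a * \<delta>" using x a by (simp add: abs_mult)
    moreover have "g x = (x ^ k - \<xi> ^ k) - a * (x - \<xi>)"
      using \<xi>(3) by (simp add: g_def algebra_simps)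
    moreover have "2 * (real k * \<delta>) \<le> a * \<delta>"
      using mult_right_mono[of "2 * real k" a \<delta>] a \<delta> by simp
    ultimately have "\<bar>g x\<bar> \<ge> a * \<delta> / 2" by linarith
    then have "(a * \<delta> / 2)\<^sup>2 \<le> (g x)\<^sup>2"
      using a \<delta> by (metis abs_le_square_iff abs_of_nonneg divide_nonneg_nonneg less_imp_le mult_nonneg_nonneg zero_le_numeral)
    moreover have "1 * (g x)\<^sup>2 \<le> (1 + x) ^ d * (g x)\<^sup>2"
      using \<open>x > 0\<close> by (intro mult_right_mono one_le_power) auto
    ultimately have first: "(a * \<delta>)\<^sup>2 / 4 \<le> (1 + x) ^ d * (g x)\<^sup>2"
      by (simp add: power_divide)
    have "\<xi> ^ k \<le> (2 / a) ^ k" using \<xi> \<xi>0 by (intro power_mono) auto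
    moreover have "a * x - 1 = \<xi> ^ k + a * (x - \<xi>)"
      using \<xi>eq by (simp add: algebra_simps)
    moreover have "\<bar>a * (x - \<xi>)\<bar> = a * \<delta>" using x a by (simp add: abs_mult)
    moreover have "\<xi> ^ k \<ge> 0" using \<xi>0 by simp
    ultimately have "\<bar>a * x - 1\<bar> \<le> 2 ^ k / a ^ k + 1 / a ^ k"
      using a\<delta>1 unfolding power_divide by linarith
    then have "\<bar>a * x - 1\<bar> \<le> (2 ^ k + 1) / a ^ k" by (simp add: add_divide_distrib)
    then have "\<bar>a * x - 1\<bar>\<^sup>2 \<le> ((2 ^ k + 1) / a ^ k)\<^sup>2" by (intro power_mono) auto
    then have "(a * x - 1)\<^sup>2 \<le> ((2 ^ k + 1) / a ^ k)\<^sup>2" by simp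
    moreover have "x ^ j \<le> (3 / a) ^ j" using xa \<open>x > 0\<close> by (intro power_mono) auto
    ultimately have "x ^ j * (a * x - 1)\<^sup>2 \<le> (3 / a) ^ j * ((2 ^ k + 1) / a ^ k)\<^sup>2"
      using a by (intro mult_mono) auto
    also have "\<dots> = 3 ^ j * (2 ^ k + 1)\<^sup>2 / (a ^ j * a ^ (2 * k))"
      by (simp add: power_divide power_mult mult.commute)
    finally have second: "x ^ j * (a * x - 1)\<^sup>2 \<le> 3 ^ j * (2 ^ k + 1)\<^sup>2 / (a ^ j * a ^ (2 * k))" .
    have "(a * \<delta>)\<^sup>2 = c\<^sup>2 / (a ^ j * a ^ (2 * k))"
    proof -
      have "(\<beta> ^ j)\<^sup>2 = a ^ j" "(a ^ k)\<^sup>2 = a ^ (2 * k)"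
        by (simp_all only: a_def power_mult[symmetric] mult.commute mult.left_commute)
      then show ?thesis unfolding a\<delta> power_divide by simp
    qed
    also have "c\<^sup>2 = 9 * 9 ^ j * (2 ^ k + 1)\<^sup>2"
    proof -
      have "((3 :: real) ^ j)\<^sup>2 = (3\<^sup>2) ^ j" by (simp only: power_mult[symmetric] mult.commute)
      then show ?thesis unfolding c power_mult_distrib by simp
    qed
    finally have eq: "(a * \<delta>)\<^sup>2 / 4 = (9 / 4 * 9 ^ j) * ((2 ^ k + 1)\<^sup>2 / (a ^ j * a ^ (2 * k)))"
      by simp
    have "(2 :: real) ^ k + 1 > 0" by (simp add: add_pos_pos)
    then have "(2 ^ k + 1)\<^sup>2 / (a ^ j * a ^ (2 * k)) > 0"
      using a by (intro divide_pos_pos mult_pos_pos zero_less_power)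
    moreover have "(9 / 4 :: real) * 9 ^ j > 2 * 3 ^ j"
    proof -
      have "(3 :: real) ^ j \<le> 9 ^ j" by (intro power_mono) auto
      moreover have "(3 :: real) ^ j > 0" by simp
      ultimately show ?thesis by linarith
    qed
    ultimately have "(2 * 3 ^ j) * ((2 ^ k + 1)\<^sup>2 / (a ^ j * a ^ (2 * k))) < (a * \<delta>)\<^sup>2 / 4"
      unfolding eq by (rule mult_strict_right_mono[rotated])
    then have "2 * (x ^ j * (a * x - 1)\<^sup>2) < (a * \<delta>)\<^sup>2 / 4"
      using second by simp
    then show ?thesis using first by (simp add: f)
  qed
  have "poly ?f \<xi> * poly ?f (\<xi> - \<delta>) < 0" "poly ?f \<xi> * poly ?f (\<xi> + \<delta>) < 0"
    using neg pos[of "\<xi> - \<delta>"] pos[of "\<xi> + \<delta>"] \<delta> by (simp_all add: mult_neg_pos)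
  then show ?thesis
    using two_real_roots_if_sign_changes[OF \<delta>] unfolding \<delta>_def c_def \<beta>_def by blast
qed

lemma tangent_family:
  assumes "k = 2 ^ e" "k \<ge> 2" "j \<ge> 1" "j + 2 \<le> d + 2 * k"
    and \<Phi>: "\<And>a. even a \<Longrightarrow> \<Phi> (tangent_poly d k j a)"
  shows "close_root_family \<Phi> (d + 2 * k) 4 (j + 2 * k + 2)"
proof -
  \<comment> \<open>The coefficients of \<open>1\<close>, \<open>a\<close> and \<open>a\<^sup>2\<close> in the expansion in powers of the parameter.\<close>
  define U V W :: "int poly" where "U = [:1, 1:] ^ d * (monom 1 k + 1)\<^sup>2 - 2 * monom 1 j"
    and "V = 4 * (monom 1 j * [:0, 1:]) - 2 * ([:1, 1:] ^ d * (monom 1 k + 1) * [:0, 1:])"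
    and "W = [:1, 1:] ^ d * [:0, 1:]\<^sup>2 - 2 * (monom 1 j * [:0, 1:]\<^sup>2)"
  have "tangent_poly d k j a = U + smult a V + smult (a\<^sup>2) W" for a
  proof -
    define A X :: "int poly" where "A = [:a:]" and "X = [:0, 1:]"
    have 1: "[:1, -a:] = 1 - A * X" "[:-1, a:] = A * X - 1"
      by (simp_all add: A_def X_def one_pCons)
    have 2: "smult a q = A * q" "smult (a\<^sup>2) q = A * A * q" for q
      by (simp_all add: A_def power2_eq_square)
    show ?thesis
      unfolding tangent_poly_def U_def V_def W_def 1 2 smult_numeral X_def[symmetric]
      by (simp add: power2_eq_square algebra_simps)
  qed
  then obtain K where K: "\<And>a i. a \<ge> 1 \<Longrightarrow> \<bar>coeff (tangent_poly d k j a) i\<bar> \<le> K * a\<^sup>2"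
    using coeff_bound_quadratic[of U V W] by auto
  define C :: int where "C = 3 * 3 ^ j * (2 ^ k + 1)"
  have "C > 0" unfolding C_def by (simp add: add_pos_pos)
  then have "C \<ge> 1" by linarith
  show ?thesis
  proof (rule close_root_familyI[where b\<^sub>0 = C and Q = "\<lambda>b. tangent_poly d k j (b\<^sup>2)" and C = "2 * of_int C"])
    fix b :: int and i assume b: "b \<ge> C"
    then have "1 \<le> b\<^sup>2" using \<open>C \<ge> 1\<close> by (simp add: one_le_power)
    then show "\<bar>coeff (tangent_poly d k j (b\<^sup>2)) i\<bar> \<le> K * b ^ 4"
      using K[of "b\<^sup>2" i] by (simp flip: power_mult)
  next
    fix b :: int assume b: "b \<ge> C" "even b"
    show "\<Phi> (tangent_poly d k j (b\<^sup>2))" "irreducible_over_rat (tangent_poly d k j (b\<^sup>2))"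
      "degree (tangent_poly d k j (b\<^sup>2)) = d + 2 * k"
      using b assms irreducible_tangent degree_tangent by auto
    show "\<exists>x y :: real. poly (map_poly of_int (tangent_poly d k j (b\<^sup>2))) x = 0
        \<and> poly (map_poly of_int (tangent_poly d k j (b\<^sup>2))) y = 0
        \<and> x \<noteq> y \<and> \<bar>x - y\<bar> \<le> 2 * of_int C / of_int b ^ (j + 2 * k + 2)"
      using close_roots_tangent[of k j b d] assms b(1) unfolding C_def by auto
  qed
qed

section \<open>A cubic family\<close>

text \<open>
  This is \<open>(t\<^sup>2 x + 1)^3 - x ((1 - t^3) x - t)^2\<close>, the numerator of \<open>y^3 - t y - 1\<close> after the substitution
  \<open>y = (t\<^sup>2 x + 1) / ((1 - t^3) x - t)\<close>, which has determinant \<open>-1\<close>. The fraction \<open>t\<^sup>2 / (1 - t^3)\<close> is a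
  convergent of the small root (close to \<open>-1 / t\<close>) of \<open>y^3 - t y - 1\<close>; therefore the coefficients stay of
  order \<open>t^4\<close>. The other two roots, close to \<open>\<plusminus>sqrt t\<close>, are not approximated and come very close to
  each other under the transformation.
\<close>
definition cubic_poly :: "int \<Rightarrow> int poly" where
  "cubic_poly t = [:1, 2 * t\<^sup>2, t ^ 4 + 2 * t, 2 * t ^ 3 - 1:]"

lemma degree_cubic: "degree (cubic_poly t) = 3"
proof -
  have "2 * t ^ 3 - 1 \<noteq> 0" by presburger
  then show ?thesis by (simp add: cubic_poly_def)
qed

text \<open>
  For \<open>t\<close> divisible by \<open>3\<close> the polynomial is \<open>-(x - 1)^3\<close> modulo \<open>3\<close>, and its value at \<open>1\<close> is congruent to
  \<open>2 t\<close> modulo \<open>9\<close>.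
\<close>
lemma irreducible_cubic:
  assumes "t mod 9 = 3"
  shows "irreducible_over_rat (cubic_poly t)"
proof -
  define w where "w = t div 3"
  obtain N where N: "t = 9 * N + 3" using assms by (metis mult_div_mod_eq)
  then have w: "t = 3 * w" "w = 3 * N + 1" by (simp_all add: w_def)
  define R where "R = [:0, 6 * w\<^sup>2 + 1, 27 * w ^ 4 + 2 * w - 1, 18 * w ^ 3:]"
  show ?thesis
  proof (rule eisenstein_shifted[where l = 3 and s = 1 and c = "-1" and R = R and n = 3])
    have cube: "[:-1, 1:] ^ 3 = [:-1, 3, -3, 1 :: int:]"
      by (simp add: power3_eq_cube)
    show "cubic_poly t = smult (-1) ([:-1, 1:] ^ 3) + smult 3 R"
      unfolding cube cubic_poly_def R_def w(1)
      by (simp add: power_mult_distrib algebra_simps)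
    have "poly (cubic_poly t) 1 = 9 * (9 * w ^ 4 + 6 * w ^ 3 + 2 * w\<^sup>2 + 2 * N) + 6"
    proof -
      have "poly (cubic_poly t) 1 = 81 * w ^ 4 + 54 * w ^ 3 + 18 * w\<^sup>2 + 6 * w"
        unfolding cubic_poly_def w(1) by (simp add: power_mult_distrib)
      then show ?thesis using w(2) by algebra
    qed
    moreover have "\<not> 9 dvd 9 * u + (6 :: int)" for u by presburger
    moreover have "(3 :: int)\<^sup>2 = 9" by simp
    ultimately show "\<not> 3\<^sup>2 dvd poly (cubic_poly t) 1" by metis
  qed (use degree_cubic in auto)
qed

lemma poly_cubic:
  "poly (map_poly of_int (cubic_poly t)) (x :: real)
     = (of_int t ^ 2 * x + 1) ^ 3 - x * ((1 - of_int t ^ 3) * x - of_int t)\<^sup>2"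
  unfolding cubic_poly_def by (simp add: map_poly_of_int_simps) algebra

text \<open>
  The value \<open>x\<close> is the preimage of the root \<open>r\<close> of \<open>y^3 - s y - 1\<close> under the Moebius transformation.
\<close>
lemma cubic_root_moebius:
  fixes r s :: real
  assumes r: "r ^ 3 = s * r + 1" and D: "s\<^sup>2 + r * (s ^ 3 - 1) \<noteq> 0"
  defines "x \<equiv> - (1 + r * s) / (s\<^sup>2 + r * (s ^ 3 - 1))"
  shows "(s ^ 2 * x + 1) ^ 3 - x * ((1 - s ^ 3) * x - s)\<^sup>2 = 0"
proof -
  define D where "D = s\<^sup>2 + r * (s ^ 3 - 1)"
  have xD: "x * D = - (1 + r * s)" and "D \<noteq> 0" using assms by (simp_all add: D_def)
  have 1: "(s ^ 2 * x + 1) * D = - r"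
  proof -
    have "(s ^ 2 * x + 1) * D = s ^ 2 * (x * D) + D" by (simp add: algebra_simps)
    also have "\<dots> = - r" unfolding xD unfolding D_def by algebra
    finally show ?thesis .
  qed
  have 2: "((1 - s ^ 3) * x - s) * D = - 1"
  proof -
    have "((1 - s ^ 3) * x - s) * D = (1 - s ^ 3) * (x * D) - s * D" by (simp add: algebra_simps)
    also have "\<dots> = - 1" unfolding xD unfolding D_def by algebra
    finally show ?thesis .
  qed
  have "((s ^ 2 * x + 1) ^ 3 - x * ((1 - s ^ 3) * x - s)\<^sup>2) * D ^ 3
      = ((s ^ 2 * x + 1) * D) ^ 3 - (x * D) * (((1 - s ^ 3) * x - s) * D)\<^sup>2"
    by algebra
  also have "\<dots> = 0" unfolding 1 2 xD using r by algebra
  finally show ?thesis using \<open>D \<noteq> 0\<close> by simp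
qed

text \<open>
  With \<open>b = sqrt s\<close>, the roots \<open>r1\<close> and \<open>r2\<close> of \<open>y^3 - s y - 1\<close> close to \<open>b\<close> and \<open>-b\<close> have denominators \<open>D\<close> of
  order \<open>b^7\<close>. As the transformation is unimodular, the distance of their preimages is
  \<open>(r1 - r2) / \<bar>D r1 D r2\<bar>\<close>, which has order \<open>b^(-13)\<close>; the height has order \<open>s^4 = b^8\<close>.
\<close>
lemma cubic_family: "close_root_family (\<lambda>_. True) 3 8 13"
  unfolding close_root_family_def
proof (rule exI[of _ 3], rule exI[of _ 64], rule allI)
  fix B :: real
  \<comment> \<open>The residue of \<open>t\<close> modulo \<open>9\<close> yields irreducibility, and \<open>t \<ge> B\<^sup>2\<close> yields \<open>b \<ge> B\<close>.\<close>
  define N where "N = max 1 \<lceil>B\<^sup>2\<rceil>"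
  define t where "t = 9 * N + 3"
  define s where "s = real_of_int t"
  define b where "b = sqrt s"
  have N: "N \<ge> 1" "B\<^sup>2 \<le> of_int N" by (simp_all add: N_def ceiling_le_iff[symmetric])
  then have s: "s \<ge> 12" "s \<ge> B\<^sup>2" by (simp_all add: s_def t_def)
  have bs: "b\<^sup>2 = s" using s by (simp add: b_def)
  have "B \<le> b" unfolding b_def using s by (intro real_le_rsqrt)
  have b3: "b \<ge> 3" unfolding b_def using s by (intro real_le_rsqrt) simp
  define F where "F = [:-1, -s, 0, 1:]"
  have F: "poly F y = y ^ 3 - s * y - 1" for y by (simp add: F_def power3_eq_cube algebra_simps)
  have cube: "b ^ 3 = s * b" using bs by (simp add: power2_eq_square power3_eq_cube flip: bs)
  have b27: "s * b \<ge> 12 * 3" using s b3 by (intro mult_mono) auto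
  have F': "poly F (c * b) = (c ^ 3 - c) * (s * b) - 1" for c
    unfolding F power_mult_distrib cube by (simp add: algebra_simps)
  have signs: "poly F b < 0" "poly F (2 * b) > 0" "poly F (-b) < 0" "poly F (-b/2) > 0"
    using F'[of 1] F'[of 2] F'[of "-1"] F'[of "-1/2"] b27 by (simp_all add: power3_eq_cube)
  obtain r1 where r1: "b < r1" "r1 < 2 * b" "poly F r1 = 0"
    using poly_IVT_pos[of b "2 * b" F] signs b3 by auto
  obtain r2 where r2: "-b < r2" "r2 < -b/2" "poly F r2 = 0"
    using poly_IVT_pos[of "-b" "-b/2" F] signs b3 by auto
  define D where "D = (\<lambda>r. s\<^sup>2 + r * (s ^ 3 - 1))"
  have D: "\<bar>D r\<bar> \<ge> b ^ 7 / 4" if r: "\<bar>r\<bar> \<ge> b / 2" for r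
  proof -
    have "(s ^ 3 - 1) \<ge> 0" using s by simp
    then have "b / 2 * (s ^ 3 - 1) \<le> \<bar>r\<bar> * \<bar>s ^ 3 - 1\<bar>"
      using r by (intro mult_mono) auto
    then have "\<bar>r * (s ^ 3 - 1)\<bar> \<ge> b / 2 * (s ^ 3 - 1)"
      by (simp only: abs_mult)
    moreover have "b / 2 * (s ^ 3 - 1) = b ^ 7 / 2 - b / 2"
      by (simp add: algebra_simps flip: bs power_mult power_Suc)
    moreover have "s\<^sup>2 = b ^ 4" by (simp flip: bs power_mult)
    moreover have "b ^ 4 + b / 2 \<le> b ^ 7 / 4"
    proof -
      have "b ^ 4 * 27 \<le> b ^ 4 * b ^ 3" using b3 power_mono[of 3 b 3] by (intro mult_left_mono) auto
      also have "b ^ 4 * b ^ 3 = b ^ 7" by (simp flip: power_add)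
      finally have "b ^ 4 * 27 \<le> b ^ 7" .
      moreover have "b \<le> b ^ 4" using b3 by (intro self_le_power) auto
      ultimately show ?thesis using b3 by linarith
    qed
    moreover have "s\<^sup>2 \<ge> 0" by simp
    ultimately show ?thesis unfolding D_def by linarith
  qed
  have D1: "\<bar>D r1\<bar> \<ge> b ^ 7 / 4" and D2: "\<bar>D r2\<bar> \<ge> b ^ 7 / 4"
    using r1 r2 b3 by (intro D; simp add: abs_if)+
  have b7: "b ^ 7 > 0" using b3 by simp
  then have nz: "D r1 \<noteq> 0" "D r2 \<noteq> 0" using D1 D2 by auto
  define x where "x = (\<lambda>r. - (1 + r * s) / D r)"
  have root: "poly (map_poly of_int (cubic_poly t)) (x r) = 0" if "poly F r = 0" "D r \<noteq> 0" for r
    using cubic_root_moebius[of r s] that unfolding poly_cubic s_def[symmetric] x_def D_def F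
    by (simp add: algebra_simps)
  have diff: "x r1 - x r2 = - (r1 - r2) / (D r1 * D r2)"
  proof -
    have "x r1 - x r2 = (- (1 + r1 * s) * D r2 + (1 + r2 * s) * D r1) / (D r1 * D r2)"
      unfolding x_def using nz by (simp add: field_simps)
    also have "- (1 + r1 * s) * D r2 + (1 + r2 * s) * D r1 = - (r1 - r2)"
      unfolding D_def by algebra
    finally show ?thesis .
  qed
  have "\<bar>x r1 - x r2\<bar> = (r1 - r2) / (\<bar>D r1\<bar> * \<bar>D r2\<bar>)"
    using r1 r2 b3 unfolding diff by (simp add: abs_mult)
  also have "\<dots> \<le> (4 * b) / (b ^ 7 / 4 * (b ^ 7 / 4))"
    using r1 r2 b3 D1 D2 b7 by (intro frac_le mult_mono) auto
  also have "\<dots> = 64 / b ^ 13"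
    using b3 by (simp add: field_simps flip: power_add power_Suc)
  finally have close: "\<bar>x r1 - x r2\<bar> \<le> 64 / b ^ 13" .
  have "x r1 \<noteq> x r2"
    using diff nz r1 r2 b3 by auto
  have height: "real_of_int \<bar>coeff (cubic_poly t) i\<bar> \<le> 3 * b ^ 8" for i
  proof -
    have t: "t \<ge> 3" using N by (simp add: t_def)
    have p: "1 \<le> t ^ 4" "1 \<le> t\<^sup>2" "t\<^sup>2 \<le> t ^ 4" "t \<le> t ^ 4" "t ^ 3 \<le> t ^ 4" "1 \<le> t ^ 3"
      using t power_increasing[of 2 4 t] power_increasing[of 1 4 t] power_increasing[of 3 4 t] by auto
    have "\<bar>1\<bar> \<le> 3 * t ^ 4" "\<bar>2 * t\<^sup>2\<bar> \<le> 3 * t ^ 4" "\<bar>t ^ 4 + 2 * t\<bar> \<le> 3 * t ^ 4"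
        "\<bar>2 * t ^ 3 - 1\<bar> \<le> 3 * t ^ 4" "\<bar>0\<bar> \<le> 3 * t ^ 4"
      by - (rule abs_leI; use p t in linarith)+
    then have "\<bar>coeff (cubic_poly t) i\<bar> \<le> 3 * t ^ 4"
      unfolding cubic_poly_def coeff_pCons by (auto split: nat.splits simp del: abs_0 abs_1)
    then have "real_of_int \<bar>coeff (cubic_poly t) i\<bar> \<le> real_of_int (3 * t ^ 4)"
      by (simp only: of_int_le_iff)
    also have "\<dots> = 3 * b ^ 8" by (simp flip: s_def bs power_mult)
    finally show ?thesis .
  qed
  have "irreducible_over_rat (cubic_poly t)"
    by (rule irreducible_cubic) (simp add: t_def)
  then show "\<exists>b\<ge>B. \<exists>P :: int poly. \<exists>x y :: real. True \<and> irreducible_over_rat P \<and> degree P = 3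
      \<and> (\<forall>i. real_of_int \<bar>coeff P i\<bar> \<le> 3 * b ^ 8)
      \<and> poly (map_poly of_int P) x = 0 \<and> poly (map_poly of_int P) y = 0
      \<and> x \<noteq> y \<and> \<bar>x - y\<bar> \<le> 64 / b ^ 13"
    using \<open>B \<le> b\<close> degree_cubic height root[OF r1(3) nz(1)] root[OF r2(3) nz(2)] \<open>x r1 \<noteq> x r2\<close> close
    by blast
qed

section \<open>The lower bound\<close>

lemma power_of_2_above_quarter:
  fixes n :: nat
  assumes "n \<ge> 4"
  obtains e :: nat where "2 ^ e \<ge> (2 :: nat)" "2 * 2 ^ e \<le> n" "n < 4 * 2 ^ e"
proof -
  have "1 \<le> n div 2" using assms by simp
  then obtain e where e: "2 ^ e \<le> n div 2" "n div 2 < 2 ^ (e + 1)"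
    using ex_power_ivl1[of 2 "n div 2"] by auto
  have bounds: "2 * 2 ^ e \<le> n" "n < 4 * 2 ^ e" using e by simp_all
  then have "2 ^ e \<noteq> (1 :: nat)" using assms by linarith
  moreover have "2 ^ e \<ge> (1 :: nat)" by simp
  ultimately show ?thesis using that[OF _ bounds] by linarith
qed

text \<open>
  In degree at least \<open>4\<close> the choice \<open>j = n - 2\<close> gives \<open>(n + 2 k) / 4\<close>; from \<open>n < 4 k\<close> and \<open>k \<ge> 2\<close> it follows
  that \<open>6 k \<ge> n + 4\<close>, which is the inequality needed.
\<close>
lemma kappa_lower_bound:
  assumes "n \<ge> 2"
  shows "ereal ((real n + 1) / 3) \<le> kappa n"
proof -
  consider "n = 2" | "n = 3" | "n \<ge> 4" using assms by linarith
  then show ?thesis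
  proof cases
    case 1
    have "ereal (real (2 + 2) / real 4) \<le> kappa 2"
      by (rule kappa_ge[OF mignotte_family[where \<Phi> = "\<lambda>_. True"]]) auto
    then show ?thesis using 1 by simp
  next
    case 2
    have "ereal ((real n + 1) / 3) \<le> ereal (real 13 / real 8)" using 2 by simp
    also have "\<dots> \<le> kappa n" using kappa_ge[OF cubic_family] 2 by simp
    finally show ?thesis .
  next
    case 3
    obtain e where e: "2 ^ e \<ge> (2 :: nat)" "2 * 2 ^ e \<le> n" "n < 4 * 2 ^ e"
      using power_of_2_above_quarter[OF 3] .
    define k d where "k = (2 :: nat) ^ e" and "d = n - 2 * k"
    have n: "d + 2 * k = n" using e(2) by (simp add: d_def k_def)
    have "close_root_family (\<lambda>_. True) (d + 2 * k) 4 ((n - 2) + 2 * k + 2)"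
      using e 3 n by (intro tangent_family[where e = e]) (auto simp: k_def)
    moreover have "(n - 2) + 2 * k + 2 = n + 2 * k" using 3 by simp
    ultimately have bound: "ereal (real (n + 2 * k) / real 4) \<le> kappa n"
      unfolding n by (intro kappa_ge) (use 3 in auto)
    have "n + 1 \<le> 4 * k" "2 \<le> k" using e by (simp_all add: k_def)
    then have "real (n + 1) \<le> real (4 * k)" "real 2 \<le> real k"
      by (simp_all only: of_nat_le_iff)
    then have "(real n + 1) / 3 \<le> real (n + 2 * k) / real 4" by simp
    then have "ereal ((real n + 1) / 3) \<le> ereal (real (n + 2 * k) / real 4)" by simp
    then show ?thesis using bound by (rule order_trans)
  qed
qed

text \<open>
  The second summand must have degree below \<open>m\<close> for the polynomial to be monic, so \<open>j = m - 3\<close> here.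
\<close>
lemma kappa_star_lower_bound:
  assumes "m \<ge> 3"
  shows "ereal (real m / 3) \<le> kappa_star m"
proof -
  consider "m = 3" | "m \<ge> 4" using assms by linarith
  then show ?thesis
  proof cases
    case 1
    have monic: "lead_coeff (mignotte_poly 3 a) = 1" for a
      unfolding degree_mignotte[of 3, simplified] by (simp add: mignotte_poly_def power2_eq_square numeral_3_eq_3)
    have "ereal (real m / 3) \<le> ereal (real (3 + 2) / real 4)" using 1 by simp
    also have "\<dots> \<le> kappa_star 3"
      by (rule kappa_star_ge[OF mignotte_family]) (use monic in auto)
    finally show ?thesis using 1 by simp
  next
    case 2
    obtain e where e: "2 ^ e \<ge> (2 :: nat)" "2 * 2 ^ e \<le> m" "m < 4 * 2 ^ e"
      using power_of_2_above_quarter[OF 2] .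
    define k d where "k = (2 :: nat) ^ e" and "d = m - 2 * k"
    have m: "d + 2 * k = m" using e(2) by (simp add: d_def k_def)
    have "close_root_family (\<lambda>P. lead_coeff P = 1) (d + 2 * k) 4 ((m - 3) + 2 * k + 2)"
    proof (rule tangent_family[OF k_def])
      show "lead_coeff (tangent_poly d k (m - 3) a) = 1" if "even a" for a
        using monic_tangent[OF k_def that] e 2 m by (simp add: k_def)
    qed (use e 2 m in \<open>auto simp: k_def\<close>)
    then have bound: "ereal (real ((m - 3) + 2 * k + 2) / real 4) \<le> kappa_star m"
      unfolding m by (intro kappa_star_ge) auto
    have "m + 1 \<le> 4 * k" "2 \<le> k" using e by (simp_all add: k_def)
    then have "real (m + 1) \<le> real (4 * k)" "real 2 \<le> real k"
      by (simp_all only: of_nat_le_iff)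
    then have "real m / 3 \<le> real ((m - 3) + 2 * k + 2) / real 4"
      using 2 by (simp add: of_nat_diff)
    then have "ereal (real m / 3) \<le> ereal (real ((m - 3) + 2 * k + 2) / real 4)" by simp
    then show ?thesis using bound by (rule order_trans)
  qed
qed

theorem theorem1:
  fixes n :: nat
  assumes "n \<ge> 2"
  shows "min (kappa n) (kappa_star (n + 1)) \<ge> ereal ((real n + 1) / 3)"
proof (rule min.boundedI)
  show "ereal ((real n + 1) / 3) \<le> kappa n"
    using assms by (rule kappa_lower_bound)
  have "3 \<le> n + 1" using assms by linarith
  from kappa_star_lower_bound[OF this]
  show "ereal ((real n + 1) / 3) \<le> kappa_star (n + 1)"
    by (simp only: of_nat_add of_nat_1)
qed

end
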